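(* Consider symmetric loops $W:\mathbb R\to SO(4)$ that are not null-homotopic as loops in $SO(4)$. (a) Among those whose lifts satisfy $T(\tilde W(0))=\tilde W(0)$, choose for each the lift with $\tilde W(0)\in X_0$; then $\tilde W(\pi)\in X_1\sqcup Y_1$, and the loops fall into exactly two symmetric-homotopy classes, distinguished by whether $\tilde W(\pi)\in X_1$ or $\tilde W(\pi)\in Y_1$. (b) Among those whose lifts satisfy $T(\tilde W(0))=-\tilde W(0)$, choose for each the lift with $\tilde W(0)\in X_1$; then $\tilde W(\pi)\in X_0\sqcup Y_0$, and the loops fall into exactly two symmetric-homotopy classes, distinguished by whether $\tilde W(\pi)\in X_0$ or $\tilde W(\pi)\in Y_0$.
   Context: Identify $\mathbb H$ with $\mathbb R^4$ via $x_0+x_1i+x_2j+x_3k\leftrightarrow(x_0,x_1,x_2,x_3)^T$; $Sp(1)$ is the group of unit quaternions, with componentwise product and conjugation on $Sp(1)\times Sp(1)$. Let $p:Sp(1)\times Sp(1)\to SO(4)$ send $(g,h)$ to the matrix of the $\mathbb R$-linear map $x\mapsto g^{-1}xh$ (a two-to-one covering map). Let $w=\begin{pmatrix}0&-I_2\\ I_2&0\end{pmatrix}$, $\tilde w=(1,j)$, and $T(u,v)=\overline{\tilde w^{-1}(u,v)\tilde w}=(\bar u,\ j^{-1}\bar v j)$. Let $X_0=\{(1,a+bi+dk):a^2+b^2+d^2=1\}$, $Y_0=-X_0$, $X_1=\{(bi+cj+dk,\ j):b^2+c^2+d^2=1\}$, $Y_1=\{(bi+cj+dk,\ -j):b^2+c^2+d^2=1\}$.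 A symmetric loop is a continuous $2\pi$-periodic map $W:\mathbb R\to SO(4)$ with $wW(k)w^{-1}=W(-k)^{-1}$ for all $k$. A symmetric homotopy is a continuous $H:\mathbb R\times[0,1]\to SO(4)$ such that $H(\cdot,t)$ is a symmetric loop for every $t$. A lift of $W$ is a continuous $\tilde W:\mathbb R\to Sp(1)\times Sp(1)$ with $p\circ\tilde W=W$. (Physically: non-vanishing Fu–Kane–Mele invariant, with the two classes differing in the new $\mathbb Z_2$ invariant $\nu_{new}$.) *)

theory Defs
  imports "HOL-Analysis.Analysis" "HOL-Library.Numeral_Type"
begin

text \<open>Quaternions are identified with real^4: x0 + x1 i + x2 j + x3 k corresponds to the
  vector with components x $ 0, x $ 1, x $ 2, x $ 3 (index type 4 = {0,1,2,3}).\<close>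

type_synonym quat = "real ^ 4"

definition hq :: "real \<Rightarrow> real \<Rightarrow> real \<Rightarrow> real \<Rightarrow> quat" where
  "hq a b c d = (\<chi> i. if i = 0 then a else if i = 1 then b else if i = 2 then c else d)"

definition hmul :: "quat \<Rightarrow> quat \<Rightarrow> quat" where
  "hmul x y = hq
     (x$0*y$0 - x$1*y$1 - x$2*y$2 - x$3*y$3)
     (x$0*y$1 + x$1*y$0 + x$2*y$3 - x$3*y$2)
     (x$0*y$2 - x$1*y$3 + x$2*y$0 + x$3*y$1)
     (x$0*y$3 + x$1*y$2 - x$2*y$1 + x$3*y$0)"

definition hcnj :: "quat \<Rightarrow> quat" where
  "hcnj x = hq (x$0) (- x$1) (- x$2) (- x$3)"

definition hinv :: "quat \<Rightarrow> quat" where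
  "hinv x = (1 / (norm x)\<^sup>2) *\<^sub>R hcnj x"

definition hone :: quat where "hone = hq 1 0 0 0"
definition hj :: quat where "hj = hq 0 0 1 0"

definition Sp1Sp1 :: "(quat \<times> quat) set" where
  "Sp1Sp1 = {(g, h). norm g = 1 \<and> norm h = 1}"

definition SO4 :: "(real ^ 4 ^ 4) set" where
  "SO4 = {A. orthogonal_matrix A \<and> det A = 1}"

definition pcov :: "quat \<times> quat \<Rightarrow> real ^ 4 ^ 4" where
  "pcov gh = matrix (\<lambda>x. hmul (hmul (hinv (fst gh)) x) (snd gh))"

definition wmat :: "real ^ 4 ^ 4" where
  "wmat = (\<chi> r c. if (r = 2 \<and> c = 0) \<or> (r = 3 \<and> c = 1) then 1
                  else if (r = 0 \<and> c = 2) \<or> (r = 1 \<and> c = 3) then -1 else 0)"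

definition Tmap :: "quat \<times> quat \<Rightarrow> quat \<times> quat" where
  "Tmap uv = (hcnj (fst uv), hmul (hmul (hinv hj) (hcnj (snd uv))) hj)"

definition pneg :: "quat \<times> quat \<Rightarrow> quat \<times> quat" where
  "pneg uv = (- fst uv, - snd uv)"

definition X0 :: "(quat \<times> quat) set" where
  "X0 = {(hone, hq a b 0 d) | a b d. a\<^sup>2 + b\<^sup>2 + d\<^sup>2 = 1}"
definition Y0 :: "(quat \<times> quat) set" where
  "Y0 = pneg ` X0"
definition X1 :: "(quat \<times> quat) set" where
  "X1 = {(hq 0 b c d, hj) | b c d. b\<^sup>2 + c\<^sup>2 + d\<^sup>2 = 1}"
definition Y1 :: "(quat \<times> quat) set" where
  "Y1 = {(hq 0 b c d, - hj) | b c d. b\<^sup>2 + c\<^sup>2 + d\<^sup>2 = 1}"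

definition symmetric_loop :: "(real \<Rightarrow> real ^ 4 ^ 4) \<Rightarrow> bool" where
  "symmetric_loop W \<longleftrightarrow> continuous_on UNIV W \<and> (\<forall>k. W k \<in> SO4) \<and>
     (\<forall>k. W (k + 2 * pi) = W k) \<and>
     (\<forall>k. wmat ** W k ** matrix_inv wmat = matrix_inv (W (- k)))"

definition symmetric_homotopic :: "(real \<Rightarrow> real ^ 4 ^ 4) \<Rightarrow> (real \<Rightarrow> real ^ 4 ^ 4) \<Rightarrow> bool" where
  "symmetric_homotopic W1 W2 \<longleftrightarrow> (\<exists>H :: real \<times> real \<Rightarrow> real ^ 4 ^ 4.
     continuous_on (UNIV \<times> {0..1}) H \<and>
     (\<forall>t\<in>{0..1}. symmetric_loop (\<lambda>k. H (k, t))) \<and>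
     (\<forall>k. H (k, 0) = W1 k) \<and> (\<forall>k. H (k, 1) = W2 k))"

definition null_homotopic_SO4 :: "(real \<Rightarrow> real ^ 4 ^ 4) \<Rightarrow> bool" where
  "null_homotopic_SO4 W \<longleftrightarrow>
     (\<exists>a. homotopic_loops SO4 (\<lambda>t. W (2 * pi * t)) (linepath a a))"

definition is_lift :: "(real \<Rightarrow> quat \<times> quat) \<Rightarrow> (real \<Rightarrow> real ^ 4 ^ 4) \<Rightarrow> bool" where
  "is_lift L W \<longleftrightarrow> continuous_on UNIV L \<and> (\<forall>k. L k \<in> Sp1Sp1 \<and> pcov (L k) = W k)"

end

theory Submission
  imports Defs
begin

text \<open>The map \<open>pcov\<close> is a two-fold covering of \<open>SO4\<close> by the simply connected space
  \<open>Sp1Sp1\<close>, with fibres \<open>{x, - x}\<close>, and \<open>pcov (Tmap x)\<close> is the inverse of the conjugate of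
  \<open>pcov x\<close> by \<open>wmat\<close>. Hence a lift \<open>L\<close> of a symmetric loop satisfies
  \<open>Tmap (L k) = s L(- k)\<close> with a constant sign \<open>s\<close>, and the loop is essential iff
  \<open>L (k + 2 pi) = - L k\<close>. Then \<open>L 0\<close> and \<open>L pi\<close> lie in the eigensets of \<open>Tmap\<close> for \<open>s\<close>
  and \<open>- s\<close>; each eigenset is a pair of antipodal 2-spheres. Cases (a) and (b) of the theorem
  are \<open>s = 1\<close> and \<open>s = - 1\<close> of one statement.

  A symmetric homotopy lifts, and by continuity its values at \<open>k = 0\<close> and \<open>k = pi\<close> stay in
  one sphere each, so the sphere containing \<open>L pi\<close> is an invariant. Conversely, if the end points
  of two lifts lie in the same spheres, paths in these spheres together with the two lifts give a
  map on the boundary of the square \<open>[0, pi] \<times> [0, 1]\<close>. Both components of it extend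
  over the square, as every map from a circle to the 3-sphere is null-homotopic, and the symmetries
  carry the extension from the fundamental domain \<open>[0, pi]\<close> to the whole line.\<close>

section \<open>Quaternions\<close>

lemma four_eq_zero: "(4::4) = 0"
  by simp

lemma forall_index4: "(\<forall>i::4. P i) \<longleftrightarrow> P 0 \<and> P 1 \<and> P 2 \<and> P 3"
  unfolding forall_4 four_eq_zero by blast

lemma sum_index4: "sum f (UNIV::4 set) = f 0 + f 1 + f 2 + (f 3 :: 'a::comm_monoid_add)"
  unfolding sum_4 four_eq_zero by (simp add: ac_simps)

lemma quat_eq_iff: "(x::quat) = y \<longleftrightarrow> x$0 = y$0 \<and> x$1 = y$1 \<and> x$2 = y$2 \<and> x$3 = y$3"
  by (simp add: vec_eq_iff forall_index4)

lemma hq_nth [simp]: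
  "hq a b c d $ 0 = a" "hq a b c d $ 1 = b" "hq a b c d $ 2 = c" "hq a b c d $ 3 = d"
  by (simp_all add: hq_def)

lemma hmul_nth:
  "hmul x y $ 0 = x$0*y$0 - x$1*y$1 - x$2*y$2 - x$3*y$3"
  "hmul x y $ 1 = x$0*y$1 + x$1*y$0 + x$2*y$3 - x$3*y$2"
  "hmul x y $ 2 = x$0*y$2 - x$1*y$3 + x$2*y$0 + x$3*y$1"
  "hmul x y $ 3 = x$0*y$3 + x$1*y$2 - x$2*y$1 + x$3*y$0"
  by (simp_all add: hmul_def)

lemma hcnj_nth [simp]:
  "hcnj x $ 0 = x$0" "hcnj x $ 1 = - x$1" "hcnj x $ 2 = - x$2" "hcnj x $ 3 = - x$3"
  by (simp_all add: hcnj_def)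

lemma hone_nth [simp]: "hone $ 0 = 1" "hone $ 1 = 0" "hone $ 2 = 0" "hone $ 3 = 0"
  by (simp_all add: hone_def)

lemma hj_nth [simp]: "hj $ 0 = 0" "hj $ 1 = 0" "hj $ 2 = 1" "hj $ 3 = 0"
  by (simp_all add: hj_def)

lemma inner_quat: "inner (x::quat) y = x$0*y$0 + x$1*y$1 + x$2*y$2 + x$3*y$3"
  by (simp add: inner_vec_def sum_index4)

lemma norm_quat: "(norm (x::quat))\<^sup>2 = (x$0)\<^sup>2 + (x$1)\<^sup>2 + (x$2)\<^sup>2 + (x$3)\<^sup>2"
  unfolding power2_norm_eq_inner inner_quat by (simp add: power2_eq_square)

lemma norm_quat_1: "norm (x::quat) = 1 \<longleftrightarrow> (x$0)\<^sup>2 + (x$1)\<^sup>2 + (x$2)\<^sup>2 + (x$3)\<^sup>2 = 1"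
  unfolding norm_quat[symmetric] by (simp add: power2_eq_1_iff) (metis norm_ge_zero neg_0_le_iff_le not_one_le_zero)

lemma hmul_assoc: "hmul (hmul x y) z = hmul x (hmul y z)"
  by (simp add: quat_eq_iff hmul_nth algebra_simps)

lemma hmul_hone [simp]: "hmul hone x = x" "hmul x hone = x"
  by (simp_all add: quat_eq_iff hmul_nth)

lemma hcnj_hmul: "hcnj (hmul x y) = hmul (hcnj y) (hcnj x)"
  by (simp add: quat_eq_iff hmul_nth algebra_simps)

lemma hcnj_hcnj [simp]: "hcnj (hcnj x) = x"
  by (simp add: quat_eq_iff)

lemma hcnj_hone [simp]: "hcnj hone = hone"
  by (simp add: quat_eq_iff)

lemma norm_hcnj [simp]: "norm (hcnj x) = norm x"
  by (rule power2_eq_imp_eq) (simp_all add: norm_quat)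

lemma norm_hone [simp]: "norm hone = 1"
  by (simp add: norm_quat_1)

lemma norm_hj [simp]: "norm hj = 1"
  by (simp add: norm_quat_1)

text \<open>This is Euler's four-square identity, checked on coordinates as a polynomial
  identity.\<close>

lemma norm_hmul: "norm (hmul x y) = norm x * norm y"
  by (rule power2_eq_imp_eq)
     (simp add: power_mult_distrib, simp add: norm_quat hmul_nth, algebra, simp_all)

lemma hinv_unit: "norm g = 1 \<Longrightarrow> hinv g = hcnj g"
  by (simp add: hinv_def)

lemma hmul_hcnj: "hmul x (hcnj x) = (norm x)\<^sup>2 *\<^sub>R hone" "hmul (hcnj x) x = (norm x)\<^sup>2 *\<^sub>R hone"
  unfolding norm_quat by (simp_all add: quat_eq_iff hmul_nth power2_eq_square algebra_simps)

lemma hmul_hcnj_unit: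
  assumes "norm g = 1"
  shows "hmul g (hcnj g) = hone" "hmul (hcnj g) g = hone"
    "hmul g (hmul (hcnj g) y) = y" "hmul (hcnj g) (hmul g y) = y"
proof -
  show 1: "hmul g (hcnj g) = hone" "hmul (hcnj g) g = hone"
    using assms by (simp_all add: hmul_hcnj)
  show "hmul g (hmul (hcnj g) y) = y" "hmul (hcnj g) (hmul g y) = y"
    by (simp_all add: hmul_assoc[symmetric] 1)
qed

lemma bounded_bilinear_hmul: "bounded_bilinear hmul"
  unfolding bilinear_conv_bounded_bilinear[symmetric] bilinear_def
  by (auto intro!: linearI simp: quat_eq_iff hmul_nth algebra_simps)

interpretation hmul: bounded_bilinear hmul
  by (rule bounded_bilinear_hmul)

lemma linear_hcnj: "linear hcnj"
  by (auto intro!: linearI simp: quat_eq_iff)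

lemmas continuous_on_hmul [continuous_intros] = hmul.continuous_on

lemma continuous_on_hcnj [continuous_intros]:
  "continuous_on S f \<Longrightarrow> continuous_on S (\<lambda>x. hcnj (f x))"
  by (rule bounded_linear.continuous_on[OF linear_hcnj[unfolded linear_conv_bounded_linear]])

section \<open>The covering map\<close>

lemma pcov_mult:
  "pcov (g, h) *v x = hmul (hmul (hinv g) x) h"
proof -
  have "linear (\<lambda>x. hmul (hmul (hinv g) x) h)"
    by (auto intro!: linearI simp: hmul.add_left hmul.add_right hmul.scaleR_left hmul.scaleR_right)
  then show ?thesis
    unfolding pcov_def by (simp add: matrix_works)
qed

lemma pcov_mult_unit:
  "(g, h) \<in> Sp1Sp1 \<Longrightarrow> pcov (g, h) *v x = hmul (hmul (hcnj g) x) h"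
  by (simp add: pcov_mult hinv_unit Sp1Sp1_def)

text \<open>The order of the factors is reversed because applying (g', h') first and then (g, h)
  gives g^-1 g'^-1 x h' h, so \<open>pcov\<close> is an antihomomorphism.\<close>

lemma pcov_compose:
  assumes "(g, h) \<in> Sp1Sp1" "(g', h') \<in> Sp1Sp1"
  shows "pcov (g, h) ** pcov (g', h') = pcov (hmul g' g, hmul h' h)"
proof -
  have "(hmul g' g, hmul h' h) \<in> Sp1Sp1"
    using assms by (auto simp: Sp1Sp1_def norm_hmul)
  then show ?thesis
    using assms by (auto simp: matrix_eq matrix_vector_mul_assoc[symmetric] pcov_mult_unit hcnj_hmul hmul_assoc)
qed

lemma pcov_hone: "pcov (hone, hone) = mat 1"
  by (simp add: matrix_eq pcov_mult_unit Sp1Sp1_def)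

lemma pcov_inverse:
  assumes "(g, h) \<in> Sp1Sp1"
  shows "pcov (hcnj g, hcnj h) ** pcov (g, h) = mat 1" "pcov (g, h) ** pcov (hcnj g, hcnj h) = mat 1"
proof -
  have "(hcnj g, hcnj h) \<in> Sp1Sp1" "norm g = 1" "norm h = 1"
    using assms by (auto simp: Sp1Sp1_def)
  then show "pcov (hcnj g, hcnj h) ** pcov (g, h) = mat 1"
      "pcov (g, h) ** pcov (hcnj g, hcnj h) = mat 1"
    using assms by (simp_all add: pcov_compose hmul_hcnj_unit pcov_hone)
qed

lemma Sp1Sp1_eq: "Sp1Sp1 = sphere 0 1 \<times> sphere 0 1"
  by (auto simp: Sp1Sp1_def)

lemma simply_connected_Sp1Sp1: "simply_connected Sp1Sp1"
  unfolding Sp1Sp1_eq by (intro simply_connected_Times simply_connected_sphere) simp_all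

lemma compact_Sp1Sp1: "compact Sp1Sp1"
  unfolding Sp1Sp1_eq by (intro compact_Times compact_sphere)

lemma continuous_on_pcov: "continuous_on Sp1Sp1 pcov"
proof -
  \<comment> \<open>On unit quaternions the inverse is the conjugate, so the matrix entries become
    polynomials and no division has to be handled.\<close>
  have "continuous_on Sp1Sp1 (\<lambda>x. (\<chi> i j. hmul (hmul (hcnj (fst x)) (axis j 1)) (snd x) $ i) :: real^4^4)"
    by (intro continuous_intros)
  then show ?thesis
    by (rule continuous_on_eq) (auto simp: pcov_def matrix_def hinv_unit Sp1Sp1_def)
qed

lemma orthogonal_pcov:
  assumes "x \<in> Sp1Sp1" shows "orthogonal_matrix (pcov x)"
proof -
  obtain g h where x: "x = (g, h)" by fastforce
  have "orthogonal_transformation ((*v) (pcov x))"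
    using assms unfolding x orthogonal_transformation
    by (simp add: pcov_mult_unit norm_hmul matrix_vector_mul_linear) (simp add: Sp1Sp1_def)
  then show ?thesis
    by (simp add: orthogonal_transformation_matrix)
qed

lemma continuous_on_det [continuous_intros]:
  fixes f :: "'a::topological_space \<Rightarrow> real^'n^'n"
  assumes "continuous_on S f"
  shows "continuous_on S (\<lambda>x. det (f x))"
  unfolding det_def by (intro continuous_intros assms)

text \<open>Orthogonality leaves only the values 1 and -1; the determinant is continuous on a
  connected set, hence constant, and it is 1 at the identity.\<close>

lemma det_pcov: assumes "x \<in> Sp1Sp1" shows "det (pcov x) = 1"
proof -
  have conn: "connected ((\<lambda>x. det (pcov x)) ` Sp1Sp1)"
    by (intro connected_continuous_image continuous_on_det continuous_on_pcov
        simply_connected_imp_connected simply_connected_Sp1Sp1)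
  moreover have "(\<lambda>x. det (pcov x)) ` Sp1Sp1 \<subseteq> {-1, 1}"
    using det_orthogonal_matrix orthogonal_pcov by auto
  ultimately obtain c where "(\<lambda>x. det (pcov x)) ` Sp1Sp1 \<subseteq> {c}"
    by (metis connected_finite_iff_sing finite.emptyI finite_insert finite_subset subset_refl empty_subsetI)
  moreover have "(hone, hone) \<in> Sp1Sp1" "det (pcov (hone, hone)) = 1"
    by (simp_all add: Sp1Sp1_def pcov_hone)
  ultimately have "c = 1" by force
  with assms \<open>_ \<subseteq> {c}\<close> show ?thesis by blast
qed

lemma pcov_in_SO4: "x \<in> Sp1Sp1 \<Longrightarrow> pcov x \<in> SO4"
  by (simp add: SO4_def det_pcov orthogonal_pcov)

lemma Sp1Sp1_uminus [simp]: "- x \<in> Sp1Sp1 \<longleftrightarrow> x \<in> Sp1Sp1"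
  by (cases x) (auto simp: Sp1Sp1_def)

lemma hcnj_minus [simp]: "hcnj (- x) = - hcnj x"
  by (simp add: quat_eq_iff)

lemma pcov_uminus: "x \<in> Sp1Sp1 \<Longrightarrow> pcov (- x) = pcov x"
  by (cases x) (auto simp: matrix_eq pcov_mult pcov_mult_unit hmul.minus_left hmul.minus_right
    Sp1Sp1_def hinv_unit)

text \<open>The centre of the quaternions is the real line: commuting with j kills the i and k
  components, and commuting with i kills the j component.\<close>

lemma hmul_commute_all:
  assumes "\<And>x. hmul a x = hmul x a"
  shows "a = (a$0) *\<^sub>R hone"
  using assms[of hj] assms[of "hq 0 1 0 0"] by (simp add: quat_eq_iff hmul_nth)

text \<open>If both pairs act alike, then a = g' g^-1 and b = h' h^-1 satisfy a z = z b for all z.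
  Taking z = 1 gives a = b, so a is central, hence real, and of norm 1.\<close>

lemma pcov_eq_iff:
  assumes "x \<in> Sp1Sp1" "y \<in> Sp1Sp1"
  shows "pcov x = pcov y \<longleftrightarrow> y = x \<or> y = - x"
proof
  assume eq: "pcov x = pcov y"
  obtain g h where x: "x = (g, h)" by fastforce
  obtain g' h' where y: "y = (g', h')" by fastforce
  have n: "norm g = 1" "norm h = 1" "norm g' = 1" "norm h' = 1"
    using assms by (auto simp: x y Sp1Sp1_def)
  define a b where "a = hmul g' (hcnj g)" and "b = hmul h' (hcnj h)"
  have *: "hmul a z = hmul z b" for z
  proof -
    have "hmul (hmul (hcnj g) z) h = hmul (hmul (hcnj g') z) h'"
      using eq assms unfolding x y by (metis pcov_mult_unit)
    then have "hmul (hmul g' (hmul (hmul (hcnj g) z) h)) (hcnj h)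
        = hmul (hmul g' (hmul (hmul (hcnj g') z) h')) (hcnj h)"
      by simp
    then show ?thesis
      using n by (simp add: a_def b_def hmul_assoc hmul_hcnj_unit)
  qed
  from *[of hone] have "a = b" by simp
  with * have "\<And>z. hmul a z = hmul z a" by simp
  then have a: "a = (a$0) *\<^sub>R hone" by (rule hmul_commute_all)
  moreover have "norm a = 1" using n by (simp add: a_def norm_hmul)
  ultimately have "\<bar>a$0\<bar> = 1" by (metis norm_scaleR norm_hone mult.right_neutral)
  then have "a = hone \<or> a = - hone" using a by (auto simp: abs_if split: if_splits)
  moreover have "hmul a g = g'" "hmul b h = h'"
    using n by (simp_all add: a_def b_def hmul_assoc hmul_hcnj_unit)
  ultimately show "y = x \<or> y = - x"
    using \<open>a = b\<close> by (auto simp: x y hmul.minus_left)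
next
  assume "y = x \<or> y = - x"
  then show "pcov x = pcov y" using pcov_uminus[OF assms(1)] by metis
qed

section \<open>Surjectivity of the covering map onto \<open>SO4\<close>\<close>

lemma SO4_mult: "A \<in> SO4 \<Longrightarrow> B \<in> SO4 \<Longrightarrow> A ** B \<in> SO4"
  by (auto simp: SO4_def orthogonal_matrix_mul det_mul)

text \<open>The image of \<open>pcov\<close> is closed under products and inverses. This allows a
  matrix to be simplified by multiplying it from the left with known elements of the image.\<close>

lemma pcov_image_cancel:
  assumes x: "x \<in> Sp1Sp1" and A: "pcov x ** A \<in> pcov ` Sp1Sp1"
  shows "A \<in> pcov ` Sp1Sp1"
proof -
  obtain g h where xgh: "x = (g, h)" by fastforce
  obtain g' h' where y: "(g', h') \<in> Sp1Sp1" "pcov x ** A = pcov (g', h')" using A by force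
  have c: "(hcnj g, hcnj h) \<in> Sp1Sp1" using x xgh by (auto simp: Sp1Sp1_def)
  have "A = pcov (hcnj g, hcnj h) ** (pcov x ** A)"
    using pcov_inverse(1)[of g h] x by (simp add: matrix_mul_assoc xgh)
  also have "\<dots> = pcov (hmul g' (hcnj g), hmul h' (hcnj h))"
    using pcov_compose[OF c y(1)] y(2) by simp
  finally have "A = pcov (hmul g' (hcnj g), hmul h' (hcnj h))" .
  moreover have "(hmul g' (hcnj g), hmul h' (hcnj h)) \<in> Sp1Sp1"
    using y c by (auto simp: Sp1Sp1_def norm_hmul)
  ultimately show ?thesis by blast
qed

text \<open>Supplies a rotation x -> q x q^-1 taking u to v; in the excluded antipodal case the
  unnormalised q vanishes. If u and v are also orthogonal to i, then v u lies in the span of 1 and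
  i, so q commutes with i and the rotation keeps i fixed.\<close>

lemma conjugate_imaginary:
  assumes "norm u = 1" "norm v = 1" "u$0 = 0" "v$0 = 0" "v \<noteq> - u"
  obtains q where "norm q = 1" "hmul q u = hmul v q"
    "u$1 = 0 \<Longrightarrow> v$1 = 0 \<Longrightarrow> hmul q (hq 0 1 0 0) = hmul (hq 0 1 0 0) q"
proof -
  define r where "r = hone - hmul v u" \<comment> \<open>\<open>r u = u + v = v r\<close>, as \<open>u\<close> and \<open>v\<close> square to \<open>- 1\<close>\<close>
  have uu: "hmul u u = - hone" and vv: "hmul v v = - hone"
    using assms by (auto simp: quat_eq_iff hmul_nth norm_quat_1 power2_eq_square)
  have "r \<noteq> 0"
  proof
    assume "r = 0"
    then have "hmul v u = hone" by (simp add: r_def)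
    then have "hmul v (hmul v u) = v" by simp
    then have "v = - u" by (simp add: hmul_assoc[symmetric] vv hmul.minus_left)
    with assms show False by simp
  qed
  have ru: "hmul r u = hmul v r"
    by (simp add: r_def hmul.diff_left hmul.diff_right hmul_assoc uu hmul.minus_right)
       (simp add: hmul_assoc[symmetric] vv hmul.minus_left)
  show ?thesis
  proof
    show "norm ((1 / norm r) *\<^sub>R r) = 1" using \<open>r \<noteq> 0\<close> by simp
    show "hmul ((1 / norm r) *\<^sub>R r) u = hmul v ((1 / norm r) *\<^sub>R r)"
      by (simp add: hmul.scaleR_left hmul.scaleR_right ru)
    assume "u$1 = 0" "v$1 = 0"
    then show "hmul ((1 / norm r) *\<^sub>R r) (hq 0 1 0 0) = hmul (hq 0 1 0 0) ((1 / norm r) *\<^sub>R r)"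
      using assms by (simp add: hmul.scaleR_left hmul.scaleR_right)
        (simp add: quat_eq_iff hmul_nth r_def)
  qed
qed

lemma SO4_mult_inner:
  assumes "A \<in> SO4" shows "inner (A *v x) (A *v y) = inner x y"
proof -
  have "orthogonal_transformation ((*v) A)"
    using assms by (simp add: SO4_def orthogonal_transformation_matrix matrix_vector_mul_linear)
  then show ?thesis by (simp add: orthogonal_transformation_def)
qed

lemma SO4_mult_norm: "A \<in> SO4 \<Longrightarrow> norm (A *v x) = norm x"
  by (simp add: SO4_mult_inner norm_eq_sqrt_inner)

text \<open>By orthogonality the image of k is a multiple of k, so the matrix is diagonal, and
  determinant 1 forces the remaining entry to be 1.\<close>

lemma SO4_eq_one_if_fixes_basis:
  assumes A: "A \<in> SO4" and "A *v hone = hone" "A *v hq 0 1 0 0 = hq 0 1 0 0" "A *v hj = hj"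
  shows "A = mat 1"
proof -
  have col: "A $ i $ 0 = hone $ i" "A $ i $ 1 = hq 0 1 0 0 $ i" "A $ i $ 2 = hj $ i" for i
    using arg_cong[OF assms(2), of "\<lambda>v. v $ i"] arg_cong[OF assms(3), of "\<lambda>v. v $ i"]
      arg_cong[OF assms(4), of "\<lambda>v. v $ i"]
    by (simp_all add: matrix_vector_mult_def sum_index4)
  define k where "k = A *v hq 0 0 0 1"
  have k: "A $ i $ 3 = k $ i" for i
    unfolding k_def by (simp add: matrix_vector_mult_def sum_index4)
  have "k$0 = 0" "k$1 = 0" "k$2 = 0"
    using SO4_mult_inner[OF A, of hone "hq 0 0 0 1"] SO4_mult_inner[OF A, of "hq 0 1 0 0" "hq 0 0 0 1"]
      SO4_mult_inner[OF A, of hj "hq 0 0 0 1"] unfolding k_def[symmetric] assms(2-4)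
    by (simp_all add: inner_quat)
  note col' = col(1)[of 0] col(1)[of 1] col(1)[of 2] col(1)[of 3]
      col(2)[of 0] col(2)[of 1] col(2)[of 2] col(2)[of 3]
      col(3)[of 0] col(3)[of 1] col(3)[of 2] col(3)[of 3]
      k[of 0] k[of 1] k[of 2] k[of 3] \<open>k$0 = 0\<close> \<open>k$1 = 0\<close> \<open>k$2 = 0\<close>
  have diag: "\<forall>i j. i \<noteq> j \<longrightarrow> A $ i $ j = 0"
    unfolding forall_index4 using col' by simp
  have "det A = (\<Prod>i\<in>UNIV. A $ i $ i)"
    using diag by (intro det_diagonal) auto
  also have "\<dots> = k $ 3"
    unfolding UNIV_4 four_eq_zero using col' by simp
  finally have "k $ 3 = 1" using A by (simp add: SO4_def)
  then show ?thesis
    unfolding vec_eq_iff forall_index4 using col' by (simp add: mat_def)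
qed

text \<open>Surjectivity goes by descent: multiplying from the left by elements of the image makes a
  matrix fix 1, then i, then j, after which it is the identity. The facts \<open>fix3\<close>,
  \<open>fix2\<close>, \<open>fix1\<close> run through these stages in reverse.\<close>

lemma pcov_image: "pcov ` Sp1Sp1 = SO4"
proof
  show "pcov ` Sp1Sp1 \<subseteq> SO4" using pcov_in_SO4 by blast
  have i: "norm (hq 0 1 0 0) = 1" by (simp add: norm_quat_1)
  have fix3: "A \<in> pcov ` Sp1Sp1" if "A \<in> SO4" "A *v hone = hone" "A *v hq 0 1 0 0 = hq 0 1 0 0" "A *v hj = hj" for A
    using SO4_eq_one_if_fixes_basis[OF that] pcov_hone by (auto intro!: image_eqI[of _ _ "(hone, hone)"] simp: Sp1Sp1_def)
  have conj: "pcov (hcnj q, hcnj q) \<in> SO4 \<and> (hcnj q, hcnj q) \<in> Sp1Sp1 \<and>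
      (hmul q u = hmul v q \<longrightarrow> pcov (hcnj q, hcnj q) *v u = v)" if "norm q = 1" for q u v
    using that by (auto simp: pcov_in_SO4 Sp1Sp1_def pcov_mult hinv_unit hmul_assoc hmul_hcnj_unit)
  have fix2: "A \<in> pcov ` Sp1Sp1" if A: "A \<in> SO4" and one: "A *v hone = hone" and ii: "A *v hq 0 1 0 0 = hq 0 1 0 0" for A
  proof -
    define u where "u = A *v hj"
    have nu: "norm u = 1" by (simp add: u_def SO4_mult_norm A)
    have u0: "u$0 = 0" "u$1 = 0"
      using SO4_mult_inner[OF A, of hone hj] SO4_mult_inner[OF A, of "hq 0 1 0 0" hj]
      unfolding one ii u_def[symmetric] by (auto simp: inner_quat)
    obtain q where q: "norm q = 1" "hmul q u = hmul hj q" "hmul q (hq 0 1 0 0) = hmul (hq 0 1 0 0) q"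
    proof (cases "hj = - u")
      \<comment> \<open>When j goes to -j, conjugation by i repairs the sign and leaves i
        fixed.\<close>
      case True
      then have "u = - hj" by (metis minus_minus)
      then show ?thesis
        using that[of "hq 0 1 0 0"] i by (simp add: quat_eq_iff hmul_nth)
    next
      case False
      then show ?thesis
        using conjugate_imaginary[OF nu norm_hj u0(1), of thesis] u0 that by simp
    qed
    let ?R = "pcov (hcnj q, hcnj q)"
    have "?R ** A \<in> pcov ` Sp1Sp1"
      using conj[OF q(1)] q A
      by (intro fix3) (auto simp: SO4_mult matrix_vector_mul_assoc[symmetric] one ii u_def[symmetric])
    then show ?thesis using pcov_image_cancel conj q(1) by blast
  qed
  have fix1: "A \<in> pcov ` Sp1Sp1" if A: "A \<in> SO4" and one: "A *v hone = hone" for A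
  proof -
    define u where "u = A *v hq 0 1 0 0"
    have nu: "norm u = 1" by (simp add: u_def SO4_mult_norm A i)
    have u0: "u$0 = 0"
      using SO4_mult_inner[OF A, of hone "hq 0 1 0 0"]
      unfolding one u_def[symmetric] by (auto simp: inner_quat)
    obtain q where q: "norm q = 1" "hmul q u = hmul (hq 0 1 0 0) q"
    proof (cases "hq 0 1 0 0 = - u")
      \<comment> \<open>When i goes to -i, conjugation by j repairs the sign.\<close>
      case True
      then have "u = - hq 0 1 0 0" by (metis minus_minus)
      then show ?thesis
        using that[of hj] by (simp add: quat_eq_iff hmul_nth)
    next
      case False
      then show ?thesis
        using conjugate_imaginary[OF nu i u0 _ False, of thesis] that by simp
    qed
    let ?R = "pcov (hcnj q, hcnj q)"
    have "?R ** A \<in> pcov ` Sp1Sp1"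
      using conj[OF q(1)] q A
      by (intro fix2) (auto simp: SO4_mult matrix_vector_mul_assoc[symmetric] one u_def[symmetric])
    then show ?thesis using pcov_image_cancel conj q(1) by blast
  qed
  show "SO4 \<subseteq> pcov ` Sp1Sp1"
  proof
    fix A assume A: "A \<in> SO4"
    define q where "q = A *v hone"
    have q: "norm q = 1" by (simp add: q_def SO4_mult_norm A)
    then have S: "(q, hone) \<in> Sp1Sp1" by (simp add: Sp1Sp1_def)
    \<comment> \<open>The pair (q, 1) acts as x -> q^-1 x, which brings the image q of 1 back to
      1.\<close>
    have "pcov (q, hone) ** A \<in> pcov ` Sp1Sp1"
      using S A q by (intro fix1)
        (auto simp: SO4_mult pcov_in_SO4 matrix_vector_mul_assoc[symmetric] q_def[symmetric] pcov_mult_unit hmul_hcnj_unit)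
    with S show "A \<in> pcov ` Sp1Sp1" by (rule pcov_image_cancel)
  qed
qed

text \<open>Around p a, the points with a preimage off the hyperplane orthogonal to a form an evenly
  covered set \<open>T\<close>; its sheets are the parts of \<open>C\<close> in the two open
  half-spaces \<open>U a\<close> and \<open>U (- a)\<close>. Each sheet contains exactly one point
  of every antipodal pair over \<open>T\<close>, and compactness of \<open>C\<close> makes p a
  closed map, so p is a homeomorphism on each sheet.\<close>

lemma antipodal_covering_space:
  fixes p :: "'a::euclidean_space \<Rightarrow> 'b::t2_space"
  assumes C: "compact C" and p: "continuous_on C p" and im: "p ` C = S" and "0 \<notin> C"
    and neg: "\<And>x. x \<in> C \<Longrightarrow> - x \<in> C"
    and fib: "\<And>x y. x \<in> C \<Longrightarrow> y \<in> C \<Longrightarrow> p x = p y \<longleftrightarrow> y = x \<or> y = - x"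
  shows "covering_space C p S"
proof
  fix x assume "x \<in> S"
  then obtain a where a: "a \<in> C" "x = p a" using im by blast
  define T where "T = S - p ` (C \<inter> {y. a \<bullet> y = 0})"
  define U where "U b = C \<inter> {y. b \<bullet> y > 0}" for b
  have closed_image: "closed (p ` (C \<inter> K))" if "closed K" for K
    using that C p
    by (meson compact_Int_closed compact_continuous_image compact_imp_closed continuous_on_subset inf_le1)
  have p_neg: "p (- y) = p y" if "y \<in> C" for y
    using that neg fib by metis
  have in_T: "p y \<in> T \<longleftrightarrow> a \<bullet> y \<noteq> 0" if "y \<in> C" for y
  proof
    assume "a \<bullet> y \<noteq> 0"
    have "p y \<notin> p ` (C \<inter> {y. a \<bullet> y = 0})"
    proof
      assume "p y \<in> p ` (C \<inter> {y. a \<bullet> y = 0})"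
      then obtain z where z: "z \<in> C" "a \<bullet> z = 0" "p z = p y" by auto
      then have "y = z \<or> y = - z" using fib[OF z(1) that] by blast
      with z \<open>a \<bullet> y \<noteq> 0\<close> show False by auto
    qed
    moreover have "p y \<in> S" using that im by blast
    ultimately show "p y \<in> T" by (simp add: T_def)
  qed (use that in \<open>auto simp: T_def\<close>)
  have image_U: "p ` U b = T" if b: "b = a \<or> b = - a" for b
  proof
    show "p ` U b \<subseteq> T" using b by (auto simp: U_def in_T)
    show "T \<subseteq> p ` U b"
    proof
      fix z assume z: "z \<in> T"
      then obtain y where y: "y \<in> C" "z = p y" using im by (auto simp: T_def)
      then have "b \<bullet> y \<noteq> 0" using z b in_T by auto
      then have "y \<in> U b \<or> - y \<in> U b" using y neg by (auto simp: U_def)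
      then show "z \<in> p ` U b" using y p_neg by (metis image_eqI)
    qed
  qed
  have homeo: "\<exists>q. homeomorphism (U b) T p q" if b: "b = a \<or> b = - a" for b
  proof (rule homeomorphism_injective_closed_map)
    show "continuous_on (U b) p" using p by (rule continuous_on_subset) (auto simp: U_def)
    show "p ` U b = T" using image_U b .
    show "inj_on p (U b)"
    proof (rule inj_onI)
      fix y z assume *: "y \<in> U b" "z \<in> U b" "p y = p z"
      then have "z = y \<or> z = - y" using fib by (auto simp: U_def)
      with * show "y = z" by (auto simp: U_def)
    qed
    fix K assume "closedin (top_of_set (U b)) K"
    then obtain K' where K': "closed K'" "K = U b \<inter> K'" by (auto simp: closedin_closed)
    \<comment> \<open>No point over \<open>T\<close> lies on the hyperplane, so the open half-space
      can be replaced by the closed one; the set being mapped is then closed in the compact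
      \<open>C\<close>.\<close>
    have "p ` K = T \<inter> p ` (C \<inter> (K' \<inter> {y. b \<bullet> y \<ge> 0}))"
    proof
      show "p ` K \<subseteq> T \<inter> p ` (C \<inter> (K' \<inter> {y. b \<bullet> y \<ge> 0}))"
        using image_U[OF b] by (auto simp: K' U_def intro!: imageI)
      show "T \<inter> p ` (C \<inter> (K' \<inter> {y. b \<bullet> y \<ge> 0})) \<subseteq> p ` K"
        using b by (auto simp: K' U_def in_T intro!: imageI)
    qed
    moreover have "closed (p ` (C \<inter> (K' \<inter> {y. b \<bullet> y \<ge> 0})))"
      by (intro closed_image closed_Int K' closed_halfspace_ge)
    ultimately show "closedin (top_of_set T) (p ` K)"
      by (auto simp: closedin_closed)
  qed (rule exI)
  show "\<exists>T. x \<in> T \<and> openin (top_of_set S) T \<and>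
      (\<exists>v. \<Union> v = C \<inter> p -` T \<and> (\<forall>u\<in>v. openin (top_of_set C) u) \<and>
           pairwise disjnt v \<and> (\<forall>u\<in>v. \<exists>q. homeomorphism u T p q))"
  proof (intro exI conjI)
    show "x \<in> T" using a \<open>0 \<notin> C\<close> in_T by auto
    have "closed (p ` (C \<inter> {y. a \<bullet> y = 0}))"
      by (intro closed_image closed_hyperplane)
    then show "openin (top_of_set S) T"
      unfolding T_def Diff_eq by (metis open_Compl openin_open)
    show "\<Union> {U a, U (- a)} = C \<inter> p -` T"
      by (auto simp: U_def in_T)
    have "openin (top_of_set C) (U b)" for b
      unfolding U_def by (intro openin_open_Int open_halfspace_gt)
    then show "\<forall>u\<in>{U a, U (- a)}. openin (top_of_set C) u" by blast
    show "pairwise disjnt {U a, U (- a)}"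
      by (auto simp: pairwise_insert disjnt_def U_def)
    show "\<forall>u\<in>{U a, U (- a)}. \<exists>q. homeomorphism u T p q" using homeo by blast
  qed
qed (use p im in auto)

lemma covering_pcov: "covering_space Sp1Sp1 pcov SO4"
proof (rule antipodal_covering_space)
  show "0 \<notin> Sp1Sp1" by (auto simp: Sp1Sp1_def zero_prod_def)
qed (auto simp: compact_Sp1Sp1 continuous_on_pcov pcov_image pcov_eq_iff)

text \<open>Reduces an identity between two maps into the covering space to its image under
  \<open>pcov\<close> and its value at a single point.\<close>

lemma pcov_lift_unique:
  fixes f g :: "'a::topological_space \<Rightarrow> quat \<times> quat"
  assumes "connected S" "continuous_on S f" "continuous_on S g" "f ` S \<subseteq> Sp1Sp1" "g ` S \<subseteq> Sp1Sp1"
    and eq: "\<And>x. x \<in> S \<Longrightarrow> pcov (f x) = pcov (g x)"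
    and "a \<in> S" "f a = g a" "x \<in> S"
  shows "f x = g x"
proof (rule covering_space_lift_unique[OF covering_pcov, where T = S and f = "pcov \<circ> f" and a = a])
  show "continuous_on S (pcov \<circ> f)"
    using assms by (intro continuous_on_compose continuous_on_subset[OF continuous_on_pcov]) auto
qed (use assms pcov_in_SO4 in \<open>auto simp: image_subset_iff\<close>)

section \<open>The involution\<close>

text \<open>The matrix is right multiplication by j: it sends 1, i, j, k to j, k, -1, -i.
  Conjugation by it can thus be computed in the covering group.\<close>

lemma wmat_eq_pcov: "wmat = pcov (hone, hj)"
  unfolding matrix_eq
  by (simp add: pcov_mult_unit Sp1Sp1_def)
     (simp add: quat_eq_iff wmat_def matrix_vector_mult_def sum_index4 hmul_nth)

lemma matrix_inv_eqI:
  fixes A B :: "real^'n^'n"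
  assumes "A ** B = mat 1" "B ** A = mat 1"
  shows "matrix_inv A = B"
proof -
  have "A ** matrix_inv A = mat 1 \<and> matrix_inv A ** A = mat 1"
    unfolding matrix_inv_def by (rule someI[of _ B]) (use assms in simp)
  then show ?thesis
    by (metis assms(2) matrix_mul_assoc matrix_mul_lid matrix_mul_rid)
qed

lemma matrix_inv_pcov:
  "(g, h) \<in> Sp1Sp1 \<Longrightarrow> matrix_inv (pcov (g, h)) = pcov (hcnj g, hcnj h)"
  by (intro matrix_inv_eqI pcov_inverse)

lemma linear_Tmap: "linear Tmap"
  by (rule linearI)
    (auto simp: Tmap_def linear_add[OF linear_hcnj] linear_cmul[OF linear_hcnj]
      hmul.add_left hmul.add_right hmul.scaleR_left hmul.scaleR_right)

lemma continuous_on_Tmap [continuous_intros]: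
  "continuous_on S f \<Longrightarrow> continuous_on S (\<lambda>x. Tmap (f x))"
  by (rule bounded_linear.continuous_on[OF linear_Tmap[unfolded linear_conv_bounded_linear]])

lemma Tmap_uminus: "Tmap (- x) = - Tmap x"
  by (rule linear_neg[OF linear_Tmap])

lemma Tmap_in_Sp1Sp1: "x \<in> Sp1Sp1 \<Longrightarrow> Tmap x \<in> Sp1Sp1"
  by (auto simp: Tmap_def Sp1Sp1_def norm_hmul hinv_unit)

lemma Tmap_Tmap: "Tmap (Tmap x) = x"
  by (cases x) (simp add: Tmap_def hinv_unit quat_eq_iff hmul_nth)

text \<open>Since \<open>pcov\<close> reverses products, conjugating by \<open>wmat\<close> replaces
  h by j^-1 h j, and inverting the matrix conjugates both quaternions; the result is
  \<open>Tmap x\<close>.\<close>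

lemma symmetry_pcov_iff:
  assumes "x \<in> Sp1Sp1" "y \<in> Sp1Sp1"
  shows "wmat ** pcov x ** matrix_inv wmat = matrix_inv (pcov y) \<longleftrightarrow> pcov y = pcov (Tmap x)"
proof -
  obtain g h where x: "x = (g, h)" by fastforce
  obtain g' h' where y: "y = (g', h')" by fastforce
  have S: "(hone, hj) \<in> Sp1Sp1" "(hone, hcnj hj) \<in> Sp1Sp1" "(g, h) \<in> Sp1Sp1" "(g', h') \<in> Sp1Sp1"
      "(hcnj g', hcnj h') \<in> Sp1Sp1"
    using assms by (auto simp: Sp1Sp1_def x y)
  then have S': "(g, hmul h hj) \<in> Sp1Sp1" "(g, hmul (hcnj hj) (hmul h hj)) \<in> Sp1Sp1"
    by (auto simp: Sp1Sp1_def norm_hmul)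
  have w: "wmat ** pcov x ** matrix_inv wmat = pcov (g, hmul (hcnj hj) (hmul h hj))"
    using S S' by (simp add: wmat_eq_pcov matrix_inv_pcov x pcov_compose)
  have "matrix_inv (pcov (g, hmul (hcnj hj) (hmul h hj))) = pcov (Tmap x)"
    using S' by (simp add: matrix_inv_pcov x Tmap_def hcnj_hmul hinv_unit hmul_assoc)
  moreover have "matrix_inv (matrix_inv (pcov y)) = pcov y"
    using S by (simp add: y matrix_inv_pcov)
  moreover have "matrix_inv (pcov (Tmap x)) = pcov (g, hmul (hcnj hj) (hmul h hj))"
    using Tmap_in_Sp1Sp1[OF assms(1)] by (simp add: x Tmap_def matrix_inv_pcov hcnj_hmul hinv_unit hmul_assoc)
  ultimately show ?thesis
    unfolding w by metis
qed

section \<open>Eigensets of the involution and their two antipodal spheres\<close>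

definition Tfix :: "real \<Rightarrow> (quat \<times> quat) set" where
  "Tfix s = {x \<in> Sp1Sp1. Tmap x = s *\<^sub>R x}"

text \<open>On the eigenset for s this coordinate takes only the values 1 and -1, and its sign tells
  the two spheres apart: the real part of g for s = 1, the j component of h for s = -1.\<close>

definition Tcoord :: "real \<Rightarrow> quat \<times> quat \<Rightarrow> real" where
  "Tcoord s x = (if s = 1 then fst x $ 0 else snd x $ 2)"

definition Tbase :: "real \<Rightarrow> (quat \<times> quat) set" where
  "Tbase s = {x \<in> Tfix s. Tcoord s x = 1}"

lemma Tmap_hq: "Tmap (g, h) = (hcnj g, hq (h$0) (h$1) (- h$2) (h$3))"
  by (simp add: Tmap_def hinv_unit quat_eq_iff hmul_nth)

lemma Tfix_1: "(g, h) \<in> Tfix 1 \<longleftrightarrow> (g = hone \<or> g = - hone) \<and> h$2 = 0 \<and> norm h = 1"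
  by (auto simp: Tfix_def Tmap_hq Sp1Sp1_def quat_eq_iff norm_quat_1 power2_eq_1_iff)

lemma Tfix_minus_1: "(g, h) \<in> Tfix (- 1) \<longleftrightarrow> (h = hj \<or> h = - hj) \<and> g$0 = 0 \<and> norm g = 1"
  by (auto simp: Tfix_def Tmap_hq Sp1Sp1_def quat_eq_iff norm_quat_1 power2_eq_1_iff)

lemma Tcoord_cases:
  assumes "x \<in> Tfix s" "s = 1 \<or> s = - 1" shows "Tcoord s x = 1 \<or> Tcoord s x = - 1"
  using assms by (cases x) (auto simp: Tcoord_def Tfix_1 Tfix_minus_1)

lemma Tcoord_uminus [simp]: "Tcoord s (- x) = - Tcoord s x"
  by (simp add: Tcoord_def)

lemma continuous_on_Tcoord [continuous_intros]:
  "continuous_on S f \<Longrightarrow> continuous_on S (\<lambda>x. Tcoord s (f x))"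
  unfolding Tcoord_def by (cases "s = 1") (auto intro!: continuous_intros)

lemma Tfix_uminus [simp]: "- x \<in> Tfix s \<longleftrightarrow> x \<in> Tfix s"
  by (auto simp: Tfix_def Tmap_uminus)

lemma Tbase_subset: "Tbase s \<subseteq> Tfix s"
  by (auto simp: Tbase_def)

lemma uminus_Tbase: "- x \<in> uminus ` Tbase s \<longleftrightarrow> x \<in> Tbase s"
  by (simp add: inj_image_mem_iff)

lemma Tfix_eq: assumes "s = 1 \<or> s = - 1" shows "Tfix s = Tbase s \<union> uminus ` Tbase s"
proof
  show "Tfix s \<subseteq> Tbase s \<union> uminus ` Tbase s"
  proof
    fix x assume x: "x \<in> Tfix s"
    then have "x \<in> Tbase s \<or> - x \<in> Tbase s"
      using Tcoord_cases[OF x assms] by (auto simp: Tbase_def)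
    then show "x \<in> Tbase s \<union> uminus ` Tbase s" by (metis UnI1 UnI2 image_eqI minus_minus)
  qed
  show "Tbase s \<union> uminus ` Tbase s \<subseteq> Tfix s"
    using Tbase_subset Tfix_uminus by blast
qed

lemma quat_eq_hq: "x = hq a b c d \<longleftrightarrow> x$0 = a \<and> x$1 = b \<and> x$2 = c \<and> x$3 = d"
  by (simp add: quat_eq_iff)

lemma Tbase_1: "Tbase 1 = X0"
proof -
  have "(g, h) \<in> Tbase 1 \<longleftrightarrow> (g, h) \<in> X0" for g h
    by (auto simp: Tbase_def Tfix_1 Tcoord_def X0_def norm_quat_1 quat_eq_hq)
  then show ?thesis by auto
qed

lemma Tbase_minus_1: "Tbase (- 1) = X1"
proof -
  have "(g, h) \<in> Tbase (- 1) \<longleftrightarrow> (g, h) \<in> X1" for g h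
    by (auto simp: Tbase_def Tfix_minus_1 Tcoord_def X1_def norm_quat_1 quat_eq_hq)
  then show ?thesis by auto
qed

lemma pneg_eq: "pneg = uminus"
  by (auto simp: pneg_def fun_eq_iff uminus_prod_def)

lemma Y0_eq: "Y0 = uminus ` Tbase 1"
  by (simp add: Y0_def pneg_eq Tbase_1)

text \<open>The sphere of imaginary units in the first factor is invariant under negation, so only
  the sign of j changes.\<close>

lemma Y1_eq: "Y1 = uminus ` Tbase (- 1)"
proof -
  have "(g, h) \<in> Y1 \<longleftrightarrow> (- g, - h) \<in> X1" for g h
  proof -
    have "(g, h) \<in> Y1 \<longleftrightarrow> h = - hj \<and> g$0 = 0 \<and> norm g = 1"
      by (auto simp: Y1_def norm_quat_1 quat_eq_hq)
    moreover have "(- g, - h) \<in> X1 \<longleftrightarrow> h = - hj \<and> g$0 = 0 \<and> norm g = 1"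
      unfolding Tbase_minus_1[symmetric] by (auto simp: Tbase_def Tfix_minus_1 Tcoord_def minus_equation_iff[of h])
    ultimately show ?thesis by simp
  qed
  then have "x \<in> Y1 \<longleftrightarrow> - x \<in> X1" for x by (cases x) simp
  then show ?thesis
    unfolding Tbase_minus_1 by (metis (no_types) uminus_Tbase Tbase_minus_1 minus_minus set_eqI)
qed

lemma hq_basis: "hq a b c d = a *\<^sub>R hone + b *\<^sub>R hq 0 1 0 0 + c *\<^sub>R hj + d *\<^sub>R hq 0 0 0 1"
  by (simp add: quat_eq_iff)

lemma continuous_on_hq [continuous_intros]:
  assumes "continuous_on S a" "continuous_on S b" "continuous_on S c" "continuous_on S d"
  shows "continuous_on S (\<lambda>x. hq (a x) (b x) (c x) (d x))"
  unfolding hq_basis[of "a _" "b _" "c _" "d _"] by (intro continuous_intros assms)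

lemma norm_vec3: "norm (v::real^3) = 1 \<longleftrightarrow> (v$1)\<^sup>2 + (v$2)\<^sup>2 + (v$3)\<^sup>2 = 1"
  by (simp add: norm_eq_1 inner_vec_def sum_3 power2_eq_square)

text \<open>Either set is parametrised by the unit sphere of \<open>real^3\<close>, which is
  path-connected.\<close>

lemma path_connected_Tbase:
  assumes "s = 1 \<or> s = - 1" shows "path_connected (Tbase s)"
proof -
  have sph: "path_connected (sphere (0::real^3) 1)"
    by (rule path_connected_sphere) simp
  have sph_eq: "sphere (0::real^3) 1 = {v. (v$1)\<^sup>2 + (v$2)\<^sup>2 + (v$3)\<^sup>2 = 1}"
    by (auto simp: norm_vec3)
  have ex: "\<exists>v::real^3. v$1 = a \<and> v$2 = b \<and> v$3 = c" for a b c
    by (rule exI[of _ "vector [a, b, c]"]) simp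
  have "X0 = (\<lambda>v. (hone, hq (v$1) (v$2) 0 (v$3))) ` sphere (0::real^3) 1"
    unfolding sph_eq X0_def using ex by (auto simp: image_iff) metis
  moreover have "X1 = (\<lambda>v. (hq 0 (v$1) (v$2) (v$3), hj)) ` sphere (0::real^3) 1"
    unfolding sph_eq X1_def using ex by (auto simp: image_iff) metis
  moreover have "path_connected ((\<lambda>v. (hone, hq (v$1) (v$2) 0 (v$3))) ` sphere (0::real^3) 1)"
      "path_connected ((\<lambda>v. (hq 0 (v$1) (v$2) (v$3), hj)) ` sphere (0::real^3) 1)"
    by (intro path_connected_continuous_image sph continuous_intros)+
  ultimately show ?thesis
    using assms Tbase_1 Tbase_minus_1 by metis
qed

section \<open>Lifts of symmetric loops\<close>

lemma is_lift_scale: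
  assumes "is_lift L W" "c = 1 \<or> c = - 1"
  shows "is_lift (\<lambda>k. c *\<^sub>R L k) W"
proof -
  have "continuous_on UNIV (\<lambda>k. c *\<^sub>R L k)"
    using assms(1) unfolding is_lift_def by (intro continuous_intros) auto
  moreover have "c *\<^sub>R L k \<in> Sp1Sp1 \<and> pcov (c *\<^sub>R L k) = W k" for k
  proof -
    have "L k \<in> Sp1Sp1" "pcov (L k) = W k" using assms(1) by (auto simp: is_lift_def)
    then show ?thesis using pcov_uminus[of "L k"] assms(2) by auto
  qed
  ultimately show ?thesis by (simp add: is_lift_def)
qed

lemma is_lift_sign:
  assumes "is_lift L W" "is_lift M W"
  obtains c where "c = 1 \<or> c = - 1" "L k = c *\<^sub>R M k"
proof -
  have "L k = M k \<or> L k = - M k"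
    using assms pcov_eq_iff[of "M k" "L k"] by (simp add: is_lift_def)
  then show ?thesis using that[of 1] that[of "- 1"] by auto
qed

lemma is_lift_unique:
  assumes L: "is_lift L W" and M: "is_lift M W" and "L a = M a"
  shows "L k = M k"
  by (rule pcov_lift_unique[of UNIV L M a]) (use assms in \<open>auto simp: is_lift_def\<close>)

text \<open>A closed lift contracts in the simply connected covering space, and the contraction
  projects to \<open>SO4\<close>.\<close>

lemma null_homotopic_if_lift_closed:
  assumes L: "is_lift L W" and closed: "L (2 * pi) = L 0"
  shows "null_homotopic_SO4 W"
proof -
  let ?l = "\<lambda>t. L (2 * pi * t)"
  have "continuous_on {0..1} ?l"
    using L unfolding is_lift_def by (auto intro!: continuous_intros elim: continuous_on_compose2)
  then have "path ?l \<and> path_image ?l \<subseteq> Sp1Sp1 \<and> pathfinish ?l = pathstart ?l \<and> L 0 \<in> Sp1Sp1"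
    using L closed
    by (auto simp: path_def path_image_def pathfinish_def pathstart_def is_lift_def)
  then have "homotopic_loops Sp1Sp1 ?l (linepath (L 0) (L 0))"
    using simply_connected_Sp1Sp1 unfolding simply_connected_eq_contractible_loop_any by blast
  then have "homotopic_loops SO4 (pcov \<circ> ?l) (pcov \<circ> linepath (L 0) (L 0))"
    by (rule homotopic_loops_continuous_image) (auto simp: continuous_on_pcov pcov_in_SO4)
  moreover have "pcov \<circ> ?l = (\<lambda>t. W (2 * pi * t))"
    using L by (auto simp: is_lift_def fun_eq_iff)
  moreover have "pcov \<circ> linepath (L 0) (L 0) = linepath (W 0) (W 0)"
    using L by (auto simp: is_lift_def fun_eq_iff linepath_refl)
  ultimately show ?thesis
    unfolding null_homotopic_SO4_def by metis
qed

text \<open>By monodromy, a null-homotopic loop would have a lift ending where the lift of a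
  constant path ends.\<close>

lemma not_null_homotopic_if_lift_open:
  assumes L: "is_lift L W" and "L (2 * pi) \<noteq> L 0"
  shows "\<not> null_homotopic_SO4 W"
proof
  assume "null_homotopic_SO4 W"
  then obtain a where "homotopic_loops SO4 (\<lambda>t. W (2 * pi * t)) (linepath a a)"
    by (auto simp: null_homotopic_SO4_def)
  \<comment> \<open>Monodromy needs fixed end points, so the free homotopy of loops is turned into a
    homotopy of paths to the constant path at \<open>W 0\<close>.\<close>
  from homotopic_loops_imp_homotopic_paths_null[OF this]
  have hom: "homotopic_paths SO4 (\<lambda>t. W (2 * pi * t)) (linepath (W 0) (W 0))"
    by (simp add: pathstart_def)
  let ?l = "\<lambda>t. L (2 * pi * t)"
  have "continuous_on {0..1} ?l"
    using L unfolding is_lift_def by (auto intro!: continuous_intros elim: continuous_on_compose2)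
  then have "pathfinish ?l = pathfinish (\<lambda>t. L 0)"
    using L hom homotopic_paths_imp_path[OF hom] homotopic_paths_imp_subset[OF hom]
    by (intro covering_space_monodromy[OF covering_pcov _ _ _ _ hom])
       (auto simp: path_def path_image_def pathstart_def is_lift_def linepath_refl)
  with assms show False by (simp add: pathfinish_def)
qed

text \<open>Both sides lift W. At 0 they agree up to sign, and the other sign would close up the
  lift and make W null-homotopic.\<close>

lemma lift_antiperiodic:
  assumes W: "symmetric_loop W" "\<not> null_homotopic_SO4 W" and L: "is_lift L W"
  shows "L (k + 2 * pi) = - L k"
proof (rule pcov_lift_unique[of UNIV "\<lambda>k. L (k + 2 * pi)" "\<lambda>k. - L k" 0])
  have per: "W (k + 2 * pi) = W k" for k using W by (simp add: symmetric_loop_def)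
  have LS: "L k \<in> Sp1Sp1" "pcov (L k) = W k" for k using L by (simp_all add: is_lift_def)
  show "pcov (L (k + 2 * pi)) = pcov (- L k)" for k
    by (simp add: LS per pcov_uminus[OF LS(1)])
  have "pcov (L 0) = pcov (L (0 + 2 * pi))" by (simp only: LS per)
  then have "L (0 + 2 * pi) = L 0 \<or> L (0 + 2 * pi) = - L 0"
    using pcov_eq_iff[OF LS(1) LS(1)] by blast
  with null_homotopic_if_lift_closed[OF L] W show "L (0 + 2 * pi) = - L 0" by auto
  show "continuous_on UNIV (\<lambda>k. L (k + 2 * pi))" "continuous_on UNIV (\<lambda>k. - L k)"
    using L unfolding is_lift_def by (auto intro!: continuous_intros elim: continuous_on_compose2)
qed (use L in \<open>auto simp: is_lift_def simp del: uminus_Pair\<close>)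

lemma symmetric_loop_lift:
  assumes W: "symmetric_loop W" and x: "x \<in> Sp1Sp1" "pcov x = W k"
  shows "W (- k) = pcov (Tmap x)"
proof -
  have "W (- k) \<in> SO4" using W by (simp add: symmetric_loop_def)
  then obtain y where y: "y \<in> Sp1Sp1" "W (- k) = pcov y" using pcov_image by blast
  have "wmat ** W k ** matrix_inv wmat = matrix_inv (W (- k))"
    using W by (simp add: symmetric_loop_def)
  then show ?thesis using x y symmetry_pcov_iff by metis
qed

text \<open>Both sides lift the reversed loop k -> W(-k), and the condition at 0 says that they
  start at the same point.\<close>

lemma lift_symmetric:
  assumes W: "symmetric_loop W" and L: "is_lift L W" and s: "s = 1 \<or> s = - 1"
    and L0: "L 0 \<in> Tfix s"
  shows "Tmap (L k) = s *\<^sub>R L (- k)"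
proof (rule pcov_lift_unique[of UNIV "\<lambda>k. Tmap (L k)" "\<lambda>k. s *\<^sub>R L (- k)" 0])
  have "pcov (s *\<^sub>R L (- k)) = W (- k)" for k
    using is_lift_scale[OF L s] by (simp add: is_lift_def)
  then show "pcov (Tmap (L k)) = pcov (s *\<^sub>R L (- k))" for k
    using symmetric_loop_lift[OF W] L by (metis is_lift_def)
  show "continuous_on UNIV (\<lambda>k. Tmap (L k))" "continuous_on UNIV (\<lambda>k. s *\<^sub>R L (- k))"
    using L unfolding is_lift_def by (auto intro!: continuous_intros elim: continuous_on_compose2)
qed (use L L0 Tmap_in_Sp1Sp1 is_lift_scale[OF L s] in \<open>simp_all add: is_lift_def Tfix_def image_subset_iff\<close>)

text \<open>The points pi and -pi differ by one period, so antiperiodicity flips the sign: T L(pi) =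
  s L(-pi) = -s L(pi).\<close>

lemma lift_endpoint:
  assumes "symmetric_loop W" "\<not> null_homotopic_SO4 W" "is_lift L W" "s = 1 \<or> s = - 1"
    "L 0 \<in> Tfix s"
  shows "L pi \<in> Tfix (- s)"
proof -
  have "Tmap (L pi) = s *\<^sub>R L (- pi)" using assms lift_symmetric by blast
  moreover have "L pi = - L (- pi)" using lift_antiperiodic[OF assms(1-3), of "- pi"] by simp
  ultimately show ?thesis
    using assms(3) by (simp add: Tfix_def is_lift_def)
qed

section \<open>Invariance under symmetric homotopy\<close>

lemma sign_constant:
  assumes "connected S" "continuous_on S f" "\<And>x. x \<in> S \<Longrightarrow> f x = (1::real) \<or> f x = - 1" "x \<in> S" "y \<in> S"
  shows "f x = f y"
proof -
  have "finite (f ` S)"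
    by (rule finite_subset[of _ "{1, - 1}"]) (use assms in auto)
  then have "f ` S = {} \<or> (\<exists>c. f ` S = {c})"
    using connected_finite_iff_sing[OF connected_continuous_image[OF assms(2,1)]] by simp
  then obtain c where c: "f ` S \<subseteq> {c}" by (metis subset_refl empty_subsetI)
  show ?thesis
    using subsetD[OF c imageI[OF assms(4)]] subsetD[OF c imageI[OF assms(5)]] by simp
qed

lemma symmetric_homotopic_imp_same_end:
  assumes hom: "symmetric_homotopic W1 W2" and s: "s = 1 \<or> s = - 1"
    and W1: "\<not> null_homotopic_SO4 W1"
    and L1: "is_lift L1 W1" "L1 0 \<in> Tbase s" and L2: "is_lift L2 W2" "L2 0 \<in> Tbase s"
  shows "L1 pi \<in> Tbase (- s) \<longleftrightarrow> L2 pi \<in> Tbase (- s)"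
proof -
  from hom[unfolded symmetric_homotopic_def] obtain H :: "real \<times> real \<Rightarrow> real^4^4" where
    "continuous_on (UNIV \<times> {0..1}) H \<and>
     (\<forall>t\<in>{0..1}. symmetric_loop (\<lambda>k. H (k, t))) \<and>
     (\<forall>k. H (k, 0) = W1 k) \<and> (\<forall>k. H (k, 1) = W2 k)" ..
  then have H: "continuous_on (UNIV \<times> {0..1}) H"
    and Hsym: "\<And>t. t \<in> {0..1} \<Longrightarrow> symmetric_loop (\<lambda>k. H (k, t))"
    and H0: "\<And>k. H (k, 0) = W1 k" and H1: "\<And>k. H (k, 1) = W2 k" by simp_all
  define D where "D = (UNIV::real set) \<times> {0..1::real}"
  have "convex D" unfolding D_def by (intro convex_Times) auto
  have inD: "(k, t) \<in> D \<longleftrightarrow> t \<in> {0..1}" for k t by (simp add: D_def)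
  have "H \<in> D \<rightarrow> SO4"
    using Hsym by (auto simp: D_def symmetric_loop_def)
  then obtain K0 where K0: "continuous_on D K0" "K0 \<in> D \<rightarrow> Sp1Sp1" "\<And>y. y \<in> D \<Longrightarrow> pcov (K0 y) = H y"
    using covering_space_lift[OF covering_pcov convex_imp_simply_connected[OF \<open>convex D\<close>]
        convex_imp_locally_path_connected[OF \<open>convex D\<close>] H[folded D_def]] by blast
  have lift0: "is_lift (\<lambda>k. K0 (k, t)) (\<lambda>k. H (k, t))" if "t \<in> {0..1}" for t
    unfolding is_lift_def
  proof (intro conjI allI)
    show "continuous_on UNIV (\<lambda>k. K0 (k, t))"
      by (rule continuous_on_compose2[OF K0(1)]) (use that in \<open>auto intro!: continuous_intros simp: inD\<close>)
  qed (use K0 that in \<open>auto simp: inD\<close>)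
  \<comment> \<open>A lift of the homotopy is determined up to a global sign; c is the sign that
    makes it start with \<open>L1\<close>.\<close>
  obtain c where c: "c = 1 \<or> c = - 1" "L1 0 = c *\<^sub>R K0 (0, 0)"
    using is_lift_sign[OF L1(1), of "\<lambda>k. K0 (k, 0)" 0] lift0[of 0] H0 by auto
  define K where "K = (\<lambda>y. c *\<^sub>R K0 y)"
  have lift: "is_lift (\<lambda>k. K (k, t)) (\<lambda>k. H (k, t))" if "t \<in> {0..1}" for t
    unfolding K_def using is_lift_scale[OF lift0[OF that] c(1)] .
  have K: "continuous_on D K" unfolding K_def by (intro continuous_intros K0)
  have pK: "pcov (K (k, t)) = H (k, t)" "K (k, t) \<in> Sp1Sp1" if "t \<in> {0..1}" for k t
    using lift[OF that] by (auto simp: is_lift_def)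
  have KS: "K y \<in> Sp1Sp1" if "y \<in> D" for y
    using that pK(2)[of "snd y" "fst y"] by (cases y) (simp add: inD)
  have K00: "K (k, 0) = L1 k" for k
    by (rule is_lift_unique[OF _ L1(1), of _ 0]) (use lift[of 0] c H0 in \<open>auto simp: K_def\<close>)
  \<comment> \<open>The symmetry, and likewise the antiperiodicity below, is known for
    \<open>L1\<close>; comparing lifts at (0, 0) spreads it over the whole strip.\<close>
  have Ksym: "Tmap (K y) = s *\<^sub>R K (- fst y, snd y)" if "y \<in> D" for y
  proof (rule pcov_lift_unique[of D "\<lambda>y. Tmap (K y)" "\<lambda>y. s *\<^sub>R K (- fst y, snd y)" "(0, 0)"])
    show "connected D" using \<open>convex D\<close> by (rule convex_connected)
    show "continuous_on D (\<lambda>y. Tmap (K y))" by (intro continuous_intros K)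
    have "continuous_on D (\<lambda>y. K (- fst y, snd y))"
      by (rule continuous_on_compose2[OF K]) (auto intro!: continuous_intros simp: D_def)
    then show "continuous_on D (\<lambda>y. s *\<^sub>R K (- fst y, snd y))" by (intro continuous_intros)
    show "pcov (Tmap (K y)) = pcov (s *\<^sub>R K (- fst y, snd y))" if yD: "y \<in> D" for y
    proof -
      obtain k t where y: "y = (k, t)" and t: "t \<in> {0..1}" using yD by (cases y) (simp add: inD)
      have "H (- k, t) = pcov (Tmap (K y))"
        using symmetric_loop_lift[OF Hsym[OF t], of "K y" k] pK[OF t] y by simp
      moreover have "pcov (s *\<^sub>R K (- k, t)) = H (- k, t)"
        using is_lift_scale[OF lift[OF t] s] by (simp add: is_lift_def)
      ultimately show ?thesis by (simp add: y)
    qed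
    show "(\<lambda>y. Tmap (K y)) ` D \<subseteq> Sp1Sp1"
      using Tmap_in_Sp1Sp1[OF KS] by blast
    show "(\<lambda>y. s *\<^sub>R K (- fst y, snd y)) ` D \<subseteq> Sp1Sp1"
      using is_lift_scale[OF lift s] by (auto simp: D_def is_lift_def image_subset_iff)
    show "Tmap (K (0, 0)) = s *\<^sub>R K (- fst (0, 0), snd (0, 0))"
      using L1(2) by (simp add: K00 Tbase_def Tfix_def)
  qed (use that in \<open>auto simp: inD\<close>)
  have W1s: "symmetric_loop W1" using Hsym[of 0] H0 by simp
  have Kper: "K (fst y + 2 * pi, snd y) = - K y" if "y \<in> D" for y
  proof (rule pcov_lift_unique[of D "\<lambda>y. K (fst y + 2 * pi, snd y)" "\<lambda>y. - K y" "(0, 0)"])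
    show "connected D" using \<open>convex D\<close> by (rule convex_connected)
    show "continuous_on D (\<lambda>y. K (fst y + 2 * pi, snd y))"
      by (rule continuous_on_compose2[OF K]) (auto intro!: continuous_intros simp: D_def)
    show "continuous_on D (\<lambda>y. - K y)" by (intro continuous_intros K)
    show "pcov (K (fst y + 2 * pi, snd y)) = pcov (- K y)" if yD: "y \<in> D" for y
    proof -
      obtain k t where y: "y = (k, t)" and t: "t \<in> {0..1}" using yD by (cases y) (simp add: inD)
      have "H (k + 2 * pi, t) = H (k, t)" using Hsym[OF t] by (simp add: symmetric_loop_def)
      then show ?thesis using pK[OF t] by (simp add: y pcov_uminus)
    qed
    show "(\<lambda>y. K (fst y + 2 * pi, snd y)) ` D \<subseteq> Sp1Sp1"
      using pK by (auto simp: D_def image_subset_iff)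
    show "(\<lambda>y. - K y) ` D \<subseteq> Sp1Sp1"
      using KS by (simp add: image_subset_iff)
    show "K (fst (0, 0) + 2 * pi, snd (0, 0)) = - K (0, 0)"
      using lift_antiperiodic[OF W1s W1 L1(1), of 0] by (simp add: K00)
  qed (use that in \<open>auto simp: inD\<close>)
  have fix0: "K (0, t) \<in> Tfix s" if "t \<in> {0..1}" for t
    using Ksym[of "(0, t)"] pK[OF that] that by (simp add: Tfix_def inD)
  have fixpi: "K (pi, t) \<in> Tfix (- s)" if "t \<in> {0..1}" for t
    using Ksym[of "(pi, t)"] Kper[of "(- pi, t)"] pK[OF that] that by (simp add: Tfix_def inD)
  have cont: "continuous_on {0..1} (\<lambda>t. K (k, t))" for k
    by (rule continuous_on_compose2[OF K]) (auto intro!: continuous_intros simp: D_def)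
  \<comment> \<open>The left edge stays in the sphere \<open>Tbase s\<close>, which excludes the
    negative lift at time 1: the lifted homotopy ends exactly with \<open>L2\<close>.\<close>
  have "Tcoord s (K (0, 0)) = Tcoord s (K (0, 1))"
    by (rule sign_constant[of "{0..1}" "\<lambda>t. Tcoord s (K (0, t))"])
       (auto intro!: continuous_intros cont Tcoord_cases[OF _ s] fix0)
  then have c01: "Tcoord s (K (0, 1)) = 1" using L1(2) by (simp add: K00 Tbase_def)
  obtain e where e: "e = 1 \<or> e = - 1" "L2 0 = e *\<^sub>R K (0, 1)"
    using is_lift_sign[OF L2(1), of "\<lambda>k. K (k, 1)" 0] lift[of 1] H1 by auto
  have "Tcoord s (L2 0) = 1" using L2(2) by (simp add: Tbase_def)
  then have "L2 0 = K (0, 1)" using e c01 by (elim disjE) simp_all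
  then have K1: "L2 k = K (k, 1)" for k
    using is_lift_unique[OF L2(1), of "\<lambda>k. K (k, 1)" 0] lift[of 1] H1 by simp
  have s': "- s = 1 \<or> - s = - 1" using s by auto
  \<comment> \<open>The same argument on the line k = pi shows that the invariant does not
    change.\<close>
  have "Tcoord (- s) (K (pi, 0)) = Tcoord (- s) (K (pi, 1))"
    by (rule sign_constant[of "{0..1}" "\<lambda>t. Tcoord (- s) (K (pi, t))"])
       (auto intro!: continuous_intros cont Tcoord_cases[OF _ s'] fixpi)
  then show ?thesis
    using fixpi[of 0] fixpi[of 1] by (simp add: Tbase_def K00 K1)
qed

section \<open>Constructing symmetric homotopies\<close>

lemma symmetric_loop_int_period:
  assumes "symmetric_loop W" shows "W (k + 2 * pi * of_int n) = W k"
proof -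
  have per: "W (k + 2 * pi) = W k" for k using assms by (simp add: symmetric_loop_def)
  have nat: "W (k + 2 * pi * of_nat m) = W k" for k m
  proof (induction m)
    case (Suc m)
    have "k + 2 * pi * of_nat (Suc m) = (k + 2 * pi * of_nat m) + 2 * pi" by (simp add: algebra_simps)
    then show ?case using per Suc by presburger
  qed simp
  show ?thesis
  proof (cases "n \<ge> 0")
    case True
    then show ?thesis using nat[of k "nat n"] by simp
  next
    case False
    then show ?thesis using nat[of "k + 2 * pi * of_int n" "nat (- n)"] by simp
  qed
qed

text \<open>\<open>arccos (cos k)\<close> folds the line continuously onto the fundamental domain \<open>[0, pi]\<close> of the
  group generated by \<open>k \<mapsto> k + 2 pi\<close> and \<open>k \<mapsto> - k\<close>.\<close>

lemma symmetric_loop_fold: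
  assumes W: "symmetric_loop W"
    and M: "\<And>k. k \<in> {0..pi} \<Longrightarrow> M k \<in> Sp1Sp1 \<and> pcov (M k) = W k"
  shows "W k = (if sin k \<le> 0 then pcov (Tmap (M (arccos (cos k)))) else pcov (M (arccos (cos k))))"
proof -
  obtain y where y: "- pi < y" "y \<le> pi" "sin y = sin k" "cos y = cos k"
    using sincos_principal_value[of k] by blast
  then obtain n :: int where "y = k + 2 * pi * of_int n" using sin_cos_eq_iff by blast
  then have Wk: "W k = W y" using symmetric_loop_int_period[OF W, of k n] by simp
  have reflect: "W (- a) = pcov (Tmap (M a))" if "a \<in> {0..pi}" for a
    using symmetric_loop_lift[OF W] M[OF that] by blast
  consider "y = pi" | "0 < y" "y < pi" | "y \<le> 0" using y by linarith
  then show ?thesis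
  proof cases
    case 1
    \<comment> \<open>Here sin y = 0 selects the reflected formula, which computes W(-pi);
      periodicity identifies this with W(pi).\<close>
    have "W (- pi) = W pi" using symmetric_loop_int_period[OF W, of "- pi" 1] by simp
    then show ?thesis
      using 1 reflect[of pi] Wk unfolding y(3,4)[symmetric] by simp
  next
    case 2
    then show ?thesis
      using M[of y] Wk sin_gt_zero[of y] unfolding y(3,4)[symmetric] by (simp add: arccos_cos)
  next
    case 3
    have "sin y \<le> 0" using 3 y sin_ge_zero[of "- y"] by simp
    then show ?thesis
      using 3 y(1) reflect[of "- y"] Wk unfolding y(3,4)[symmetric] by (simp add: arccos_cos2)
  qed
qed

text \<open>On an eigenset \<open>Tmap\<close> changes at most the sign, which \<open>pcov\<close>
  ignores. This glues the two branches of the folded formula at multiples of pi.\<close>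

lemma pcov_Tmap_Tfix:
  assumes "x \<in> Tfix s" "s = 1 \<or> s = - 1" shows "pcov (Tmap x) = pcov x"
  using assms pcov_uminus[of x] by (auto simp: Tfix_def simp del: uminus_Pair)

text \<open>The family on \<open>[0, pi]\<close> is spread over the line by folding:
  \<open>pcov\<close> of it where sin k > 0, and \<open>pcov\<close> of its \<open>Tmap\<close>
  image elsewhere. The eigenset conditions on the two vertical edges make the branches agree where
  sin k = 0.\<close>

lemma symmetric_homotopicI:
  fixes K :: "real \<times> real \<Rightarrow> quat \<times> quat"
  assumes K: "continuous_on ({0..pi} \<times> {0..1}) K" "K ` ({0..pi} \<times> {0..1}) \<subseteq> Sp1Sp1"
    and s: "s = 1 \<or> s = - 1"
    and K0: "\<And>t. t \<in> {0..1} \<Longrightarrow> K (0, t) \<in> Tfix s"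
    and Kpi: "\<And>t. t \<in> {0..1} \<Longrightarrow> K (pi, t) \<in> Tfix (- s)"
    and W1: "symmetric_loop W1" "\<And>k. k \<in> {0..pi} \<Longrightarrow> pcov (K (k, 0)) = W1 k"
    and W2: "symmetric_loop W2" "\<And>k. k \<in> {0..pi} \<Longrightarrow> pcov (K (k, 1)) = W2 k"
  shows "symmetric_homotopic W1 W2"
proof -
  define fold where "fold = (\<lambda>k::real. arccos (cos k))"
  have fold: "fold k \<in> {0..pi}" for k
    by (simp add: fold_def arccos_lbound arccos_ubound)
  have fold_minus: "fold (- k) = fold k" and fold_per: "fold (k + 2 * pi) = fold k" for k
    by (simp_all add: fold_def)
  have KS: "K (fold k, t) \<in> Sp1Sp1" if "t \<in> {0..1}" for k t
    using K(2) fold that by blast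
  have s': "- s = 1 \<or> - s = - 1" using s by auto
  have edge: "pcov (Tmap (K (fold k, t))) = pcov (K (fold k, t))" if "t \<in> {0..1}" "sin k = 0" for k t
  proof -
    have "(cos k)\<^sup>2 = 1" using sin_cos_squared_add[of k] that(2) by simp
    then have "cos k = 1 \<or> cos k = - 1" by (simp add: power2_eq_1_iff)
    then have "fold k = 0 \<or> fold k = pi" by (auto simp: fold_def arccos_minus_1)
    then show ?thesis using K0 Kpi that pcov_Tmap_Tfix s s' by metis
  qed
  define H where "H = (\<lambda>(k, t). if sin k \<le> 0 then pcov (Tmap (K (fold k, t))) else pcov (K (fold k, t)))"
  have H_eq: "H (k, t) = (if sin k \<le> 0 then pcov (Tmap (K (fold k, t))) else pcov (K (fold k, t)))" for k t
    by (simp add: H_def)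
  have cK: "continuous_on (UNIV \<times> {0..1}) (\<lambda>y. K (fold (fst y), snd y))"
    by (rule continuous_on_compose2[OF K(1)])
       (use fold in \<open>auto intro!: continuous_intros simp: fold_def\<close>)
  have cH: "continuous_on (UNIV \<times> {0..1}) H"
  proof -
    have "continuous_on (UNIV \<times> {0..1})
      (\<lambda>y. if sin (fst y) \<le> 0 then pcov (Tmap (K (fold (fst y), snd y))) else pcov (K (fold (fst y), snd y)))"
    proof (rule continuous_on_cases_le)
      have "continuous_on (UNIV \<times> {0..1}) (\<lambda>y. pcov (Tmap (K (fold (fst y), snd y))))"
        by (rule continuous_on_compose2[OF continuous_on_pcov continuous_on_Tmap[OF cK]])
           (use KS Tmap_in_Sp1Sp1 in \<open>auto simp: image_subset_iff\<close>)
      then show "continuous_on {y \<in> UNIV \<times> {0..1}. sin (fst y) \<le> 0} (\<lambda>y. pcov (Tmap (K (fold (fst y), snd y))))"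
        by (rule continuous_on_subset) auto
      have "continuous_on (UNIV \<times> {0..1}) (\<lambda>y. pcov (K (fold (fst y), snd y)))"
        by (rule continuous_on_compose2[OF continuous_on_pcov cK])
           (use KS in \<open>auto simp: image_subset_iff\<close>)
      then show "continuous_on {y \<in> UNIV \<times> {0..1}. 0 \<le> sin (fst y)} (\<lambda>y. pcov (K (fold (fst y), snd y)))"
        by (rule continuous_on_subset) auto
      show "continuous_on (UNIV \<times> {0..1::real}) (\<lambda>y. sin (fst y) :: real)"
        by (intro continuous_intros)
    qed (auto simp: edge)
    then show ?thesis by (simp add: H_def case_prod_unfold)
  qed
  have "symmetric_loop (\<lambda>k. H (k, t))" if t: "t \<in> {0..1}" for t
    unfolding symmetric_loop_def
  proof (intro conjI allI)
    show "continuous_on UNIV (\<lambda>k. H (k, t))"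
      by (rule continuous_on_compose2[OF cH]) (use t in \<open>auto intro!: continuous_intros\<close>)
    show "H (k, t) \<in> SO4" for k
      using KS[OF t] Tmap_in_Sp1Sp1 pcov_in_SO4 by (simp add: H_eq)
    show "H (k + 2 * pi, t) = H (k, t)" for k
      by (simp add: H_eq fold_per)
    show "wmat ** H (k, t) ** matrix_inv wmat = matrix_inv (H (- k, t))" for k
    proof -
      let ?x = "K (fold k, t)"
      have x: "?x \<in> Sp1Sp1" "Tmap ?x \<in> Sp1Sp1" using KS[OF t] Tmap_in_Sp1Sp1 by blast+
      consider "sin k < 0" | "sin k = 0" | "0 < sin k" by linarith
      then show ?thesis
      proof cases
        case 1
        then have "H (k, t) = pcov (Tmap ?x)" "H (- k, t) = pcov ?x"
          by (simp_all add: H_eq fold_minus)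
        then show ?thesis using symmetry_pcov_iff[OF x(2,1)] Tmap_Tmap by simp
      next
        case 2
        \<comment> \<open>On the seam both k and -k select the reflected branch; \<open>edge\<close>
          lets \<open>H (k, t)\<close> be rewritten without the reflection.\<close>
        then have "H (k, t) = pcov ?x" "H (- k, t) = pcov (Tmap ?x)"
          using edge[OF t 2] by (simp_all add: H_eq fold_minus)
        then show ?thesis using symmetry_pcov_iff[OF x] by simp
      next
        case 3
        then have "H (k, t) = pcov ?x" "H (- k, t) = pcov (Tmap ?x)"
          by (simp_all add: H_eq fold_minus)
        then show ?thesis using symmetry_pcov_iff[OF x] by simp
      qed
    qed
  qed
  moreover have "H (k, 0) = W1 k" for k
    unfolding H_eq fold_def
    by (rule symmetric_loop_fold[OF W1(1), of "\<lambda>k. K (k, 0)", symmetric]) (use W1(2) K(2) in auto)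
  moreover have "H (k, 1) = W2 k" for k
    unfolding H_eq fold_def
    by (rule symmetric_loop_fold[OF W2(1), of "\<lambda>k. K (k, 1)", symmetric]) (use W2(2) K(2) in auto)
  ultimately show ?thesis
    unfolding symmetric_homotopic_def using cH by blast
qed

text \<open>A map from a closed subset of a cell complex extends to a sphere whose dimension is at
  least that of the complex. The square is a single cell of dimension at most 2, and
  \<open>dim\<close> makes the sphere at least two-dimensional.\<close>

lemma extend_square_to_sphere:
  fixes f :: "real \<times> real \<Rightarrow> 'a::euclidean_space"
  assumes "closed B" "B \<subseteq> {0..a} \<times> {0..b}" "continuous_on B f" "f ` B \<subseteq> sphere 0 1"
    and dim: "3 \<le> DIM('a)"
  obtains g where "continuous_on ({0..a} \<times> {0..b}) g" "g ` ({0..a} \<times> {0..b}) \<subseteq> sphere 0 1"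
    "\<And>x. x \<in> B \<Longrightarrow> g x = f x"
proof -
  let ?Q = "cbox (0, 0) (a, b)"
  have Q: "?Q = {0..a} \<times> {0..b}" by (simp add: cbox_Pair_eq)
  have poly: "polytope ({0..a} \<times> {0..b})" using polytope_interval[of "(0, 0)" "(a, b)"] unfolding Q .
  have face: "{0..a} \<times> {0..b} face_of {0..a} \<times> {0..b}" by (intro face_of_refl convex_Times) simp_all
  have "aff_dim ?Q \<le> 2" using aff_dim_le_DIM[of ?Q] by simp
  then have aff: "aff_dim ?Q < aff_dim (cball (0::'a) 1)"
    using dim by (simp add: aff_dim_cball)
  have fr: "rel_frontier (cball (0::'a) 1) = sphere 0 1" by simp
  obtain g where g: "continuous_on (\<Union> {?Q}) g" "g \<in> \<Union> {?Q} \<rightarrow> rel_frontier (cball (0::'a) 1)"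
      "\<And>x. x \<in> B \<Longrightarrow> g x = f x"
    by (rule extend_map_cell_complex_to_sphere[of "{?Q}" B "cball (0::'a) 1" f])
       (use assms aff in \<open>auto simp: poly face Q fr image_subset_iff simp del: fr\<close>)
  show thesis
  proof (rule that[of g])
    show "continuous_on ({0..a} \<times> {0..b}) g" using g(1) by (simp add: Q)
    show "g ` ({0..a} \<times> {0..b}) \<subseteq> sphere 0 1"
      using g(2) unfolding fr image_subset_iff_funcset by (simp add: Q)
  qed (rule g(3))
qed

text \<open>Here \<open>E\<close> is a parameter so that the same argument serves for both spheres
  in which the lifts can end.\<close>

lemma same_end_imp_symmetric_homotopic:
  assumes W: "symmetric_loop W1" "symmetric_loop W2" and s: "s = 1 \<or> s = - 1"
    and L1: "is_lift L1 W1" and L2: "is_lift L2 W2"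
    and start: "L1 0 \<in> Tbase s" "L2 0 \<in> Tbase s"
    and E: "E \<subseteq> Tfix (- s)" "path_connected E" "L1 pi \<in> E" "L2 pi \<in> E"
  shows "symmetric_homotopic W1 W2"
proof -
  obtain c where c: "path c" "path_image c \<subseteq> Tbase s" "pathstart c = L1 0" "pathfinish c = L2 0"
    using path_connected_Tbase[OF s] start unfolding path_connected_def by metis
  obtain d where d: "path d" "path_image d \<subseteq> E" "pathstart d = L1 pi" "pathfinish d = L2 pi"
    using E unfolding path_connected_def by metis
  have c_end: "c 0 = L1 0" "c 1 = L2 0" and d_end: "d 0 = L1 pi" "d 1 = L2 pi"
    using c d by (simp_all add: pathstart_def pathfinish_def)
  have cT: "c t \<in> Tfix s" and dT: "d t \<in> Tfix (- s)" if "t \<in> {0..1}" for t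
    using that c(2) d(2) E(1) Tbase_subset unfolding path_image_def by blast+
  \<comment> \<open>This is the map on the boundary \<open>B\<close> of the square: the paths c and
    d on the vertical sides, the lifts on the horizontal ones. The branches are compatible at the
    corners by \<open>c_end\<close> and \<open>d_end\<close>.\<close>
  define f :: "real \<times> real \<Rightarrow> quat \<times> quat" where
    "f = (\<lambda>(k, t). if k \<le> 0 then c t else if pi \<le> k then d t else if t \<le> 0 then L1 k else L2 k)"
  define B where "B = ({0} \<times> {0..1} \<union> {pi} \<times> {0..1}) \<union> ({0..pi} \<times> {0} \<union> {0..pi} \<times> {1::real})"
  have cont: "continuous_on UNIV L1" "continuous_on UNIV L2"
    using L1 L2 by (auto simp: is_lift_def)
  have "continuous_on B f"
    unfolding B_def
  proof (intro continuous_on_closed_Un closed_Un closed_Times closed_atLeastAtMost closed_singleton)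
    have "continuous_on ({0} \<times> {0..1}) (\<lambda>y. c (snd y))"
      by (rule continuous_on_compose2[OF c(1)[unfolded path_def]]) (auto intro!: continuous_intros)
    then show "continuous_on ({0} \<times> {0..1}) f"
      by (rule continuous_on_eq) (auto simp: f_def)
    have "continuous_on ({pi} \<times> {0..1}) (\<lambda>y. d (snd y))"
      by (rule continuous_on_compose2[OF d(1)[unfolded path_def]]) (auto intro!: continuous_intros)
    then show "continuous_on ({pi} \<times> {0..1}) f"
      by (rule continuous_on_eq) (use pi_gt_zero in \<open>auto simp: f_def simp del: pi_gt_zero\<close>)
    have "continuous_on ({0..pi} \<times> {0::real}) (\<lambda>y. L1 (fst y))"
      by (rule continuous_on_compose2[OF cont(1)]) (auto intro!: continuous_intros)
    then show "continuous_on ({0..pi} \<times> {0}) f"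
      by (rule continuous_on_eq) (auto simp: f_def c_end d_end)
    have "continuous_on ({0..pi} \<times> {1::real}) (\<lambda>y. L2 (fst y))"
      by (rule continuous_on_compose2[OF cont(2)]) (auto intro!: continuous_intros)
    then show "continuous_on ({0..pi} \<times> {1}) f"
      by (rule continuous_on_eq) (auto simp: f_def c_end d_end)
  qed
  then have cf: "continuous_on B (\<lambda>y. fst (f y))" "continuous_on B (\<lambda>y. snd (f y))"
    by (intro continuous_intros; assumption)+
  have "f y \<in> Sp1Sp1" if "y \<in> B" for y
    using that cT dT L1 L2 by (auto simp: B_def f_def Tfix_def is_lift_def)
  then have fS: "(\<lambda>y. fst (f y)) ` B \<subseteq> sphere 0 1" "(\<lambda>y. snd (f y)) ` B \<subseteq> sphere 0 1"
    unfolding Sp1Sp1_eq image_subset_iff mem_Times_iff by blast+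
  have B: "closed B" "B \<subseteq> {0..pi} \<times> {0..1}"
    unfolding B_def by (intro closed_Un closed_Times closed_atLeastAtMost closed_singleton) auto
  have dim: "3 \<le> DIM(quat)" by simp
  \<comment> \<open>The covering space is a product of two 3-spheres, so the two components are
    extended independently.\<close>
  obtain g h where g: "continuous_on ({0..pi} \<times> {0..1}) g" "g ` ({0..pi} \<times> {0..1}) \<subseteq> sphere 0 1"
      "\<And>y. y \<in> B \<Longrightarrow> g y = fst (f y)"
    and h: "continuous_on ({0..pi} \<times> {0..1}) h" "h ` ({0..pi} \<times> {0..1}) \<subseteq> sphere 0 1"
      "\<And>y. y \<in> B \<Longrightarrow> h y = snd (f y)"
    using extend_square_to_sphere[OF B cf(1) fS(1) dim] extend_square_to_sphere[OF B cf(2) fS(2) dim]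
    by metis
  show ?thesis
  proof (rule symmetric_homotopicI[of "\<lambda>y. (g y, h y)" s])
    show "continuous_on ({0..pi} \<times> {0..1}) (\<lambda>y. (g y, h y))"
      by (intro continuous_intros g h)
    show "(\<lambda>y. (g y, h y)) ` ({0..pi} \<times> {0..1}) \<subseteq> Sp1Sp1"
      using g(2) h(2) unfolding Sp1Sp1_eq by blast
    have gh: "(g y, h y) = f y" if "y \<in> B" for y using g(3) h(3) that by simp
    show "(g (0, t), h (0, t)) \<in> Tfix s" if "t \<in> {0..1}" for t
      using gh[of "(0, t)"] that cT by (simp add: B_def f_def)
    show "(g (pi, t), h (pi, t)) \<in> Tfix (- s)" if "t \<in> {0..1}" for t
      using gh[of "(pi, t)"] that dT by (simp add: B_def f_def not_le[THEN iffD2, OF pi_gt_zero])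
    show "pcov (g (k, 0), h (k, 0)) = W1 k" if "k \<in> {0..pi}" for k
    proof -
      have "f (k, 0) = L1 k" using that by (auto simp: f_def c_end d_end)
      then show ?thesis using gh[of "(k, 0)"] that L1 by (simp add: B_def is_lift_def)
    qed
    show "pcov (g (k, 1), h (k, 1)) = W2 k" if "k \<in> {0..pi}" for k
    proof -
      have "f (k, 1) = L2 k" using that by (auto simp: f_def c_end d_end)
      then show ?thesis using gh[of "(k, 1)"] that L2 by (simp add: B_def is_lift_def)
    qed
  qed (use s W in auto)
qed

lemma symmetric_homotopic_iff_same_end:
  assumes W1: "symmetric_loop W1" "\<not> null_homotopic_SO4 W1"
    and W2: "symmetric_loop W2" "\<not> null_homotopic_SO4 W2" and s: "s = 1 \<or> s = - 1"
    and L1: "is_lift L1 W1" "L1 0 \<in> Tbase s" and L2: "is_lift L2 W2" "L2 0 \<in> Tbase s"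
  shows "symmetric_homotopic W1 W2 \<longleftrightarrow> (L1 pi \<in> Tbase (- s) \<longleftrightarrow> L2 pi \<in> Tbase (- s))"
proof
  assume "symmetric_homotopic W1 W2"
  then show "L1 pi \<in> Tbase (- s) \<longleftrightarrow> L2 pi \<in> Tbase (- s)"
    using symmetric_homotopic_imp_same_end s W1(2) L1 L2 by blast
next
  assume same: "L1 pi \<in> Tbase (- s) \<longleftrightarrow> L2 pi \<in> Tbase (- s)"
  have s': "- s = 1 \<or> - s = - 1" using s by auto
  have ends: "L1 pi \<in> Tfix (- s)" "L2 pi \<in> Tfix (- s)"
    using lift_endpoint[OF W1 L1(1) s] lift_endpoint[OF W2 L2(1) s] L1(2) L2(2) Tbase_subset by blast+
  have pc: "path_connected (Tbase (- s))" using path_connected_Tbase[OF s'] .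
  have pc': "path_connected (uminus ` Tbase (- s))"
    by (intro path_connected_continuous_image pc continuous_intros)
  note homotopic = same_end_imp_symmetric_homotopic[OF W1(1) W2(1) s L1(1) L2(1) L1(2) L2(2)]
  show "symmetric_homotopic W1 W2"
  proof (cases "L1 pi \<in> Tbase (- s)")
    case True
    then show ?thesis using homotopic[of "Tbase (- s)"] pc same Tbase_subset by blast
  next
    case False
    then show ?thesis
      using homotopic[of "uminus ` Tbase (- s)"] pc' same ends unfolding Tfix_eq[OF s'] by blast
  qed
qed

section \<open>Normalised lifts and representatives of the classes\<close>

lemma lift_in_Tbase:
  assumes L: "is_lift L W" and s: "s = 1 \<or> s = - 1" and "L 0 \<in> Tfix s"
  obtains L' where "is_lift L' W" "L' 0 \<in> Tbase s"
proof -
  have "L 0 \<in> Tbase s \<or> - L 0 \<in> Tbase s"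
    using assms(3) Tfix_eq[OF s] by (auto simp del: uminus_Pair)
  then show thesis
    using that[of L] that[of "\<lambda>k. - L k"] L is_lift_scale[OF L, of "- 1"] by auto
qed

text \<open>Reduces the construction of representatives to formulas in the covering space. An
  antiperiodic lift never vanishes, so it cannot close up after one period, and its projection is
  essential.\<close>

lemma symmetric_loop_pcov:
  assumes L: "continuous_on UNIV L" "\<And>k. L k \<in> Sp1Sp1" "\<And>k. L (k + 2 * pi) = - L k"
    and s: "s = 1 \<or> s = - 1" and T: "\<And>k. Tmap (L k) = s *\<^sub>R L (- k)"
  shows "symmetric_loop (\<lambda>k. pcov (L k)) \<and> \<not> null_homotopic_SO4 (\<lambda>k. pcov (L k)) \<and>
    is_lift L (\<lambda>k. pcov (L k))"
proof (intro conjI)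
  show lift: "is_lift L (\<lambda>k. pcov (L k))" using L by (simp add: is_lift_def)
  have "L 0 \<noteq> 0" using L(2)[of 0] by (auto simp: Sp1Sp1_def zero_prod_def)
  moreover have "L (2 * pi) = - L 0" using L(3)[of 0] by simp
  moreover have "x = 0" if "x = - x" for x :: "quat \<times> quat"
    using that by (metis add.right_inverse scaleR_2 scaleR_eq_0_iff zero_neq_numeral)
  ultimately have "L (2 * pi) \<noteq> L 0" by metis
  then show "\<not> null_homotopic_SO4 (\<lambda>k. pcov (L k))"
    using not_null_homotopic_if_lift_open[OF lift] by blast
  show "symmetric_loop (\<lambda>k. pcov (L k))"
    unfolding symmetric_loop_def
  proof (intro conjI allI)
    show "continuous_on UNIV (\<lambda>k. pcov (L k))"
      by (rule continuous_on_compose2[OF continuous_on_pcov L(1)]) (use L(2) in blast)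
    show "pcov (L k) \<in> SO4" for k using L pcov_in_SO4 by blast
    show "pcov (L (k + 2 * pi)) = pcov (L k)" for k using L pcov_uminus by simp
    have "pcov (L (- k)) = pcov (Tmap (L k))" for k
      using s pcov_uminus[OF L(2)[of "- k"]] by (auto simp: T)
    then show "wmat ** pcov (L k) ** matrix_inv wmat = matrix_inv (pcov (L (- k)))" for k
      using symmetry_pcov_iff L(2) by blast
  qed
qed

lemma norm_hq_1: "norm (hq a b 0 0) = 1 \<longleftrightarrow> a\<^sup>2 + b\<^sup>2 = 1" "norm (hq a 0 c 0) = 1 \<longleftrightarrow> a\<^sup>2 + c\<^sup>2 = 1"
  by (simp_all add: norm_quat_1)

lemma half_shift: "cos ((k + 2 * pi) / 2) = - cos (k / 2)" "sin ((k + 2 * pi) / 2) = - sin (k / 2)"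
  by (simp_all add: add_divide_distrib)

text \<open>The half angle makes the lift antiperiodic, and the parities of cosine and sine give the
  symmetry. As k runs from 0 to pi, the first factor turns from 1 to i and the second from 1 to e j,
  so e selects the final sphere.\<close>

lemma symmetric_loop_from_Tbase_1:
  assumes e: "e = 1 \<or> e = - 1"
  obtains W L where "symmetric_loop W" "\<not> null_homotopic_SO4 W" "is_lift L W" "L 0 \<in> Tbase 1"
    "L pi = (hq 0 1 0 0, hq 0 0 e 0)"
proof
  let ?L = "\<lambda>k::real. (hq (cos (k/2)) (sin (k/2)) 0 0, hq (cos (k/2)) 0 (e * sin (k/2)) 0)"
  have ee: "e\<^sup>2 = 1" using e by auto
  have "symmetric_loop (\<lambda>k. pcov (?L k)) \<and> \<not> null_homotopic_SO4 (\<lambda>k. pcov (?L k)) \<and>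
      is_lift ?L (\<lambda>k. pcov (?L k))"
    by (rule symmetric_loop_pcov[where s = 1])
      (auto intro!: continuous_intros simp: Sp1Sp1_def norm_hq_1 power_mult_distrib ee half_shift
        Tmap_hq quat_eq_iff)
  then show "symmetric_loop (\<lambda>k. pcov (?L k))" "\<not> null_homotopic_SO4 (\<lambda>k. pcov (?L k))"
      "is_lift ?L (\<lambda>k. pcov (?L k))" by blast+
  show "?L 0 \<in> Tbase 1"
    by (auto simp: Tbase_def Tfix_1 Tcoord_def quat_eq_iff norm_quat_1)
  show "?L pi = (hq 0 1 0 0, hq 0 0 e 0)" by simp
qed

text \<open>Now the lift turns from (i, j) to (e, 1); exchanging sine and cosine supplies the sign s
  = -1 in the symmetry.\<close>

lemma symmetric_loop_from_Tbase_minus_1: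
  assumes e: "e = 1 \<or> e = - 1"
  obtains W L where "symmetric_loop W" "\<not> null_homotopic_SO4 W" "is_lift L W" "L 0 \<in> Tbase (- 1)"
    "L pi = (hq e 0 0 0, hone)"
proof
  let ?L = "\<lambda>k::real. (hq (e * sin (k/2)) (cos (k/2)) 0 0, hq (sin (k/2)) 0 (cos (k/2)) 0)"
  have ee: "e\<^sup>2 = 1" using e by auto
  have "symmetric_loop (\<lambda>k. pcov (?L k)) \<and> \<not> null_homotopic_SO4 (\<lambda>k. pcov (?L k)) \<and>
      is_lift ?L (\<lambda>k. pcov (?L k))"
    by (rule symmetric_loop_pcov[where s = "- 1"])
      (auto intro!: continuous_intros simp: Sp1Sp1_def norm_hq_1 power_mult_distrib ee half_shift
        Tmap_hq quat_eq_iff)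
  then show "symmetric_loop (\<lambda>k. pcov (?L k))" "\<not> null_homotopic_SO4 (\<lambda>k. pcov (?L k))"
      "is_lift ?L (\<lambda>k. pcov (?L k))" by blast+
  show "?L 0 \<in> Tbase (- 1)"
    by (auto simp: Tbase_def Tfix_minus_1 Tcoord_def quat_eq_iff norm_quat_1)
  show "?L pi = (hq e 0 0 0, hone)" by (simp add: quat_eq_iff)
qed

theorem theorem4:
  shows
   "(\<forall>W. symmetric_loop W \<and> \<not> null_homotopic_SO4 W \<and>
          (\<exists>L. is_lift L W \<and> Tmap (L 0) = L 0) \<longrightarrow>
          (\<exists>L. is_lift L W \<and> L 0 \<in> X0) \<and>
          (\<forall>L. is_lift L W \<and> L 0 \<in> X0 \<longrightarrow> L pi \<in> X1 \<union> Y1)) \<and>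
    (\<forall>W1 W2 L1 L2.
          symmetric_loop W1 \<and> \<not> null_homotopic_SO4 W1 \<and> is_lift L1 W1 \<and> L1 0 \<in> X0 \<and>
          symmetric_loop W2 \<and> \<not> null_homotopic_SO4 W2 \<and> is_lift L2 W2 \<and> L2 0 \<in> X0 \<longrightarrow>
          (symmetric_homotopic W1 W2 \<longleftrightarrow> (L1 pi \<in> X1 \<longleftrightarrow> L2 pi \<in> X1))) \<and>
    (\<exists>W L. symmetric_loop W \<and> \<not> null_homotopic_SO4 W \<and> is_lift L W \<and> L 0 \<in> X0 \<and> L pi \<in> X1) \<and>
    (\<exists>W L. symmetric_loop W \<and> \<not> null_homotopic_SO4 W \<and> is_lift L W \<and> L 0 \<in> X0 \<and> L pi \<in> Y1) \<and>
    (\<forall>W. symmetric_loop W \<and> \<not> null_homotopic_SO4 W \<and>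
          (\<exists>L. is_lift L W \<and> Tmap (L 0) = pneg (L 0)) \<longrightarrow>
          (\<exists>L. is_lift L W \<and> L 0 \<in> X1) \<and>
          (\<forall>L. is_lift L W \<and> L 0 \<in> X1 \<longrightarrow> L pi \<in> X0 \<union> Y0)) \<and>
    (\<forall>W1 W2 L1 L2.
          symmetric_loop W1 \<and> \<not> null_homotopic_SO4 W1 \<and> is_lift L1 W1 \<and> L1 0 \<in> X1 \<and>
          symmetric_loop W2 \<and> \<not> null_homotopic_SO4 W2 \<and> is_lift L2 W2 \<and> L2 0 \<in> X1 \<longrightarrow>
          (symmetric_homotopic W1 W2 \<longleftrightarrow> (L1 pi \<in> X0 \<longleftrightarrow> L2 pi \<in> X0))) \<and>
    (\<exists>W L. symmetric_loop W \<and> \<not> null_homotopic_SO4 W \<and> is_lift L W \<and> L 0 \<in> X1 \<and> L pi \<in> X0) \<and>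
    (\<exists>W L. symmetric_loop W \<and> \<not> null_homotopic_SO4 W \<and> is_lift L W \<and> L 0 \<in> X1 \<and> L pi \<in> Y0)"
proof -
  have ends: "L pi \<in> Tbase (- s) \<union> uminus ` Tbase (- s)"
    if "symmetric_loop W" "\<not> null_homotopic_SO4 W" "is_lift L W" "L 0 \<in> Tbase s" "s = 1 \<or> s = - 1" for W L s
  proof -
    have "- s = 1 \<or> - s = - 1" using that(5) by auto
    then show ?thesis
      using lift_endpoint[OF that(1-3) that(5)] that(4) Tbase_subset Tfix_eq by blast
  qed
  have starts: "\<exists>L. is_lift L W \<and> L 0 \<in> Tbase s"
    if "is_lift L W" "Tmap (L 0) = s *\<^sub>R L 0" "s = 1 \<or> s = - 1" for W L s
  proof -
    have "L 0 \<in> Tfix s" using that by (simp add: Tfix_def is_lift_def)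
    then show ?thesis using lift_in_Tbase[OF that(1,3)] by metis
  qed
  note iff = symmetric_homotopic_iff_same_end
  show ?thesis
    unfolding Y0_eq Y1_eq pneg_eq Tbase_1[symmetric] Tbase_minus_1[symmetric]
  proof (intro conjI allI impI; (elim conjE)?)
    fix W assume "\<exists>L. is_lift L W \<and> Tmap (L 0) = L 0"
    then show "\<exists>L. is_lift L W \<and> L 0 \<in> Tbase 1" using starts[of _ W 1] by auto
  next
    fix W L assume "symmetric_loop W" "\<not> null_homotopic_SO4 W" "is_lift L W" "L 0 \<in> Tbase 1"
    then show "L pi \<in> Tbase (- 1) \<union> uminus ` Tbase (- 1)" using ends[of W L 1] by simp
  next
    fix W1 W2 L1 L2
    assume "symmetric_loop W1" "\<not> null_homotopic_SO4 W1" "symmetric_loop W2" "\<not> null_homotopic_SO4 W2"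
      "is_lift L1 W1" "L1 0 \<in> Tbase 1" "is_lift L2 W2" "L2 0 \<in> Tbase 1"
    then show "symmetric_homotopic W1 W2 \<longleftrightarrow> (L1 pi \<in> Tbase (- 1) \<longleftrightarrow> L2 pi \<in> Tbase (- 1))"
      using iff[of W1 W2 1 L1 L2] by simp
  next
    obtain W L where "symmetric_loop W" "\<not> null_homotopic_SO4 W" "is_lift L W" "L 0 \<in> Tbase 1"
      "L pi = (hq 0 1 0 0, hq 0 0 1 0)" by (rule symmetric_loop_from_Tbase_1[of 1]) simp_all
    moreover from this(5) have "L pi \<in> Tbase (- 1)"
      by (auto simp: Tbase_def Tfix_minus_1 Tcoord_def quat_eq_iff norm_quat_1)
    ultimately show "\<exists>W L. symmetric_loop W \<and> \<not> null_homotopic_SO4 W \<and> is_lift L W \<and>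
        L 0 \<in> Tbase 1 \<and> L pi \<in> Tbase (- 1)" by blast
  next
    obtain W L where "symmetric_loop W" "\<not> null_homotopic_SO4 W" "is_lift L W" "L 0 \<in> Tbase 1"
      "L pi = (hq 0 1 0 0, hq 0 0 (- 1) 0)" by (rule symmetric_loop_from_Tbase_1[of "- 1"]) simp_all
    moreover from this(5) have "L pi \<in> uminus ` Tbase (- 1)"
      \<comment> \<open>The antipode (-i, j) of this end point has j component 1 in its second
        factor.\<close>
      using uminus_Tbase[of "- L pi" "- 1"]
      by (auto simp: Tbase_def Tfix_minus_1 Tcoord_def quat_eq_iff norm_quat_1)
    ultimately show "\<exists>W L. symmetric_loop W \<and> \<not> null_homotopic_SO4 W \<and> is_lift L W \<and>
        L 0 \<in> Tbase 1 \<and> L pi \<in> uminus ` Tbase (- 1)" by blast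
  next
    fix W assume "\<exists>L. is_lift L W \<and> Tmap (L 0) = - L 0"
    then show "\<exists>L. is_lift L W \<and> L 0 \<in> Tbase (- 1)" using starts[of _ W "- 1"] by auto
  next
    fix W L assume "symmetric_loop W" "\<not> null_homotopic_SO4 W" "is_lift L W" "L 0 \<in> Tbase (- 1)"
    then show "L pi \<in> Tbase 1 \<union> uminus ` Tbase 1" using ends[of W L "- 1"] by simp
  next
    fix W1 W2 L1 L2
    assume "symmetric_loop W1" "\<not> null_homotopic_SO4 W1" "symmetric_loop W2" "\<not> null_homotopic_SO4 W2"
      "is_lift L1 W1" "L1 0 \<in> Tbase (- 1)" "is_lift L2 W2" "L2 0 \<in> Tbase (- 1)"
    then show "symmetric_homotopic W1 W2 \<longleftrightarrow> (L1 pi \<in> Tbase 1 \<longleftrightarrow> L2 pi \<in> Tbase 1)"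
      using iff[of W1 W2 "- 1" L1 L2] by simp
  next
    obtain W L where "symmetric_loop W" "\<not> null_homotopic_SO4 W" "is_lift L W" "L 0 \<in> Tbase (- 1)"
      "L pi = (hq 1 0 0 0, hone)" by (rule symmetric_loop_from_Tbase_minus_1[of 1]) simp_all
    moreover from this(5) have "L pi \<in> Tbase 1"
      by (auto simp: Tbase_def Tfix_1 Tcoord_def quat_eq_iff norm_quat_1)
    ultimately show "\<exists>W L. symmetric_loop W \<and> \<not> null_homotopic_SO4 W \<and> is_lift L W \<and>
        L 0 \<in> Tbase (- 1) \<and> L pi \<in> Tbase 1" by blast
  next
    obtain W L where "symmetric_loop W" "\<not> null_homotopic_SO4 W" "is_lift L W" "L 0 \<in> Tbase (- 1)"
      "L pi = (hq (- 1) 0 0 0, hone)" by (rule symmetric_loop_from_Tbase_minus_1[of "- 1"]) simp_all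
    moreover from this(5) have "L pi \<in> uminus ` Tbase 1"
      using uminus_Tbase[of "- L pi" 1]
      by (auto simp: Tbase_def Tfix_1 Tcoord_def quat_eq_iff norm_quat_1)
    ultimately show "\<exists>W L. symmetric_loop W \<and> \<not> null_homotopic_SO4 W \<and> is_lift L W \<and>
        L 0 \<in> Tbase (- 1) \<and> L pi \<in> uminus ` Tbase 1" by blast
  qed
qed

end
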